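(* For all integers $r\ge1$ and $k_1,\ldots,k_r\ge0$, \[ \zeta(-k_1,\ldots,-k_r|1)=\lim_{s_1\to-k_1}\cdots\lim_{s_r\to-k_r}\zeta(s_1,\ldots,s_r), \] where $\zeta(s_1,\ldots,s_r)$ denotes the meromorphic continuation of $\sum_{0<n_1<\cdots<n_r}n_1^{-s_1}\cdots n_r^{-s_r}$.
   Context: Normalized multiple Bernoulli polynomials: for integers $k\ge0$, $\zeta(-k|z)=-\frac{B_{k+1}(z)}{k+1}$ ($B_n(z)$ the Bernoulli polynomials, $B_n=B_n(0)$), and for $r\ge2$, $k_j\ge0$, $\zeta(-k_1,\ldots,-k_r|z)=-\frac{1}{k_r+1}\zeta(-k_1,\ldots,-k_{r-2},-k_{r-1}-k_r-1|z)-\frac12\zeta(-k_1,\ldots,-k_{r-2},-k_{r-1}-k_r|z)+\sum_{q=1}^{k_r}(-k_r)_q\frac{B_{q+1}}{(q+1)!}\zeta(-k_1,\ldots,-k_{r-2},-k_{r-1}-k_r+q|z)$, with $(a)_q=a(a+1)\cdots(a+q-1)$. *)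

theory Defs
  imports "HOL-Analysis.Analysis"
begin

text \<open>Bernoulli numbers with the convention B_1 = -1/2 (so that B_n = B_n(0)),
  determined by B_0 = 1 and sum_{j=0}^{n} C(n+1,j) B_j = 0 for n >= 1.\<close>
function bernoulli_num :: "nat \<Rightarrow> complex" where
  "bernoulli_num n =
     (if n = 0 then 1
      else - (\<Sum>j<n. of_nat ((n + 1) choose j) * bernoulli_num j) / of_nat (n + 1))"
  by auto
termination by (relation "Wellfounded.measure id") auto

definition bernoulli_poly :: "nat \<Rightarrow> complex \<Rightarrow> complex" where
  "bernoulli_poly n z = (\<Sum>j\<le>n. of_nat (n choose j) * bernoulli_num j * z ^ (n - j))"

text \<open>mzn_rev (k_r # k_(r-1) # ... # k_1) z = zeta(-k_1,...,-k_r | z): the argument list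
  is stored reversed so that the recursion acts on the last two entries.\<close>
fun mzn_rev :: "nat list \<Rightarrow> complex \<Rightarrow> complex" where
  "mzn_rev [] z = 0"
| "mzn_rev [k] z = - bernoulli_poly (k + 1) z / of_nat (k + 1)"
| "mzn_rev (b # a # rest) z =
     - (1 / of_nat (b + 1)) * mzn_rev ((a + b + 1) # rest) z
     - (1 / 2) * mzn_rev ((a + b) # rest) z
     + (\<Sum>q\<in>{1..b}. pochhammer (- of_nat b) q * bernoulli_num (q + 1) / fact (q + 1)
                        * mzn_rev ((a + b - q) # rest) z)"

definition mult_zeta_neg :: "nat list \<Rightarrow> complex \<Rightarrow> complex" where
  "mult_zeta_neg ks z = mzn_rev (rev ks) z"

definition pdisc :: "complex list \<Rightarrow> real \<Rightarrow> complex list set" where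
  "pdisc z e = {w. length w = length z \<and> (\<forall>i<length z. cmod (w ! i - z ! i) < e)}"

text \<open>Holomorphic on a polydisc: (jointly) continuous and holomorphic in each variable
  separately (equivalent to holomorphy by Osgood's lemma).\<close>
definition holo_on_pdisc :: "(complex list \<Rightarrow> complex) \<Rightarrow> complex list \<Rightarrow> real \<Rightarrow> bool" where
  "holo_on_pdisc f z e \<longleftrightarrow>
     (\<forall>w\<in>pdisc z e. \<forall>\<epsilon>>0. \<exists>\<delta>>0. \<forall>v\<in>pdisc z e.
         (\<forall>i<length z. cmod (v ! i - w ! i) < \<delta>) \<longrightarrow> cmod (f v - f w) < \<epsilon>) \<and>
     (\<forall>w\<in>pdisc z e. \<forall>i<length z. (\<lambda>t. f (w[i := t])) field_differentiable (at (w ! i)))"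

definition meromorphic_Cr :: "nat \<Rightarrow> (complex list \<Rightarrow> complex) \<Rightarrow> bool" where
  "meromorphic_Cr r Z \<longleftrightarrow>
     (\<forall>z. length z = r \<longrightarrow>
        (\<exists>e>0. \<exists>f g. holo_on_pdisc f z e \<and> holo_on_pdisc g z e \<and>
            (\<exists>w\<in>pdisc z e. g w \<noteq> 0) \<and>
            (\<forall>w\<in>pdisc z e. g w \<noteq> 0 \<longrightarrow> Z w = f w / g w)))"

definition incr_tuples :: "nat \<Rightarrow> nat list set" where
  "incr_tuples r = {n. length n = r \<and> sorted_wrt (<) n \<and> (\<forall>x\<in>set n. 0 < x)}"

definition mzv_term :: "complex list \<Rightarrow> nat list \<Rightarrow> complex" where
  "mzv_term s n = (\<Prod>i<length s. (of_nat (n ! i) :: complex) powr (- (s ! i)))"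

text \<open>Z is the meromorphic continuation of the multiple zeta series in r variables:
  meromorphic on C^r and equal to the (absolutely/unconditionally) convergent series on
  some nonempty open polydisc (which determines it uniquely).\<close>
definition mzv_continuation :: "nat \<Rightarrow> (complex list \<Rightarrow> complex) \<Rightarrow> bool" where
  "mzv_continuation r Z \<longleftrightarrow> meromorphic_Cr r Z \<and>
     (\<exists>z e. length z = r \<and> e > 0 \<and>
        (\<forall>s\<in>pdisc z e. (mzv_term s has_sum Z s) (incr_tuples r)))"

text \<open>iter_lim f [a_1,...,a_r] c means
  lim_{s_1 -> a_1} lim_{s_2 -> a_2} ... lim_{s_r -> a_r} f [s_1,...,s_r] = c
  (outermost limit in s_1, innermost in s_r; each inner limit exists for all
  s in a punctured neighbourhood of the corresponding a).\<close>
fun iter_lim :: "(complex list \<Rightarrow> complex) \<Rightarrow> complex list \<Rightarrow> complex \<Rightarrow> bool" where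
  "iter_lim f [] c \<longleftrightarrow> f [] = c"
| "iter_lim f (a # as) c \<longleftrightarrow>
     (\<exists>g. (g \<longlongrightarrow> c) (at a) \<and> (\<forall>\<^sub>F s in at a. iter_lim (\<lambda>t. f (s # t)) as (g s)))"

end

(*
  Euler-Maclaurin summation over the largest index n_r, with s = s_r and l = n_(r-1), reads
    sum_{m > l} m^(-s) = sum_{j <= J} B_j / j! * (s - 1)_j / (s - 1) * l^(1 - s - j) - sum_{m > l} err_J(s, m),
  where err_J(s, m) is entire in s, is O(m^(-Re s - J)) locally uniformly in s, and vanishes at
  s = 0, -1, ..., -(J - 1).  Inserted into the multiple zeta series, it expresses the continuation in
  r variables through the one in r - 1 variables at (..., s_(r-1) + s_r + j - 1), up to a remainder
  that converges absolutely on any prescribed polydisc once J is large.  Letting s_r tend to -k_r for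
  generic s_1, ..., s_(r-1) kills the remainder and all terms with j > k_r + 1, and what is left is the
  recursion defining zeta(-k_1, ..., -k_r | z); the case r = 1 is zeta(-k) = -B_(k+1)(1) / (k + 1).

  A given continuation Z is determined by its local quotients only off analytic sets.  A separately
  holomorphic function that is not identically zero on a polydisc is nonzero at all points that are
  generic in the iterated sense used by iter_lim, so such sets affect no iterated limit; the same
  fact yields the identity theorem that carries Z = W from the region of convergence to the limit point.
*)
theory Submission
  imports Defs "HOL-Complex_Analysis.Complex_Analysis"
begin

text \<open>The number J of Euler-Maclaurin terms has to grow with the region, so no single
  continuation on all of C^r is built. For each radius N there is a function W on the polydisc of
  radius N about 0, and N is chosen for the given Z so that this polydisc contains both a point of
  convergence and the limit point.

  The obstacle is that (-k_1, ..., -k_r) may lie on polar hyperplanes and be a point of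
  indeterminacy, so that the limits cannot be taken jointly and their order matters. With s_r taken
  first, the recursion in depth r is continuous in s_r at -k_r as long as the function of depth r -
  1 is continuous in its last variable at the shifted points, which holds for generic s_1, ...,
  s_(r-1). The innermost limit is then a mere substitution, and the remaining limits are those of
  the induction hypothesis.

  Values at zeros of a denominator are arbitrary, for Z and for W alike. All comparisons are
  therefore stated for generic points.\<close>

declare bernoulli_num.simps [simp del] replicate_Suc [simp del]

subsection \<open>Iterated punctured neighbourhoods\<close>

text \<open>The quantifier pattern of \<open>iter_lim\<close>: how close a coordinate must be to its
  limit may depend on the earlier coordinates. The good points need not fill a punctured
  neighbourhood in C^r; what survives is that they meet every polydisc around the point
  (\<open>iter_ev_frequent\<close>).\<close>

fun iter_ev :: "(complex list \<Rightarrow> bool) \<Rightarrow> complex list \<Rightarrow> bool" where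
  "iter_ev P [] \<longleftrightarrow> P []"
| "iter_ev P (a # as) \<longleftrightarrow> (\<forall>\<^sub>F s in at a. iter_ev (\<lambda>t. P (s # t)) as)"

lemma iter_ev_mono:
  "iter_ev P as \<Longrightarrow> (\<And>t. length t = length as \<Longrightarrow> P t \<Longrightarrow> Q t) \<Longrightarrow> iter_ev Q as"
proof (induction as arbitrary: P Q)
  case (Cons a as)
  have "iter_ev (\<lambda>t. Q (s # t)) as" if "iter_ev (\<lambda>t. P (s # t)) as" for s
    using Cons.IH[OF that, of "\<lambda>t. Q (s # t)"] Cons.prems(2) by simp
  thus ?case using Cons.prems(1) by (auto elim: eventually_mono)
qed auto

lemma iter_ev_always: "(\<And>t. length t = length as \<Longrightarrow> Q t) \<Longrightarrow> iter_ev Q as"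
proof (induction as arbitrary: Q)
  case (Cons a as)
  show ?case by (auto intro!: always_eventually Cons)
qed auto

lemma iter_ev_conj: "iter_ev P as \<Longrightarrow> iter_ev Q as \<Longrightarrow> iter_ev (\<lambda>t. P t \<and> Q t) as"
proof (induction as arbitrary: P Q)
  case (Cons a as)
  from Cons.prems have "\<forall>\<^sub>F s in at a. iter_ev (\<lambda>t. P (s # t)) as \<and> iter_ev (\<lambda>t. Q (s # t)) as"
    by (auto intro: eventually_conj)
  thus ?case by (auto elim!: eventually_mono intro: Cons.IH)
qed auto

lemma iter_ev_ball:
  "finite A \<Longrightarrow> (\<And>i. i \<in> A \<Longrightarrow> iter_ev (P i) as) \<Longrightarrow> iter_ev (\<lambda>t. \<forall>i\<in>A. P i t) as"
proof (induction A rule: finite_induct)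
  case empty
  thus ?case by (auto intro: iter_ev_always)
next
  case (insert x F)
  have "iter_ev (\<lambda>t. P x t \<and> (\<forall>i\<in>F. P i t)) as"
    using insert by (intro iter_ev_conj) auto
  thus ?case by (auto elim: iter_ev_mono)
qed

lemma Cons_in_pdisc: "s # t \<in> pdisc (z # zs) e \<longleftrightarrow> cmod (s - z) < e \<and> t \<in> pdisc zs e"
  by (auto simp: pdisc_def less_Suc_eq_0_disj)

lemma pdisc_Cons_iff:
  "w \<in> pdisc (z # zs) e \<longleftrightarrow> (\<exists>s t. w = s # t \<and> cmod (s - z) < e \<and> t \<in> pdisc zs e)"
proof
  assume w: "w \<in> pdisc (z # zs) e"
  then obtain s t where "w = s # t" by (cases w) (auto simp: pdisc_def)
  with w show "\<exists>s t. w = s # t \<and> cmod (s - z) < e \<and> t \<in> pdisc zs e" by (auto simp: Cons_in_pdisc)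
qed (auto simp: Cons_in_pdisc)

lemma center_in_pdisc: "e > 0 \<Longrightarrow> z \<in> pdisc z e"
  by (simp add: pdisc_def)

lemma length_in_pdisc: "w \<in> pdisc z e \<Longrightarrow> length w = length z"
  by (simp add: pdisc_def)

lemma pdisc_mono: "e \<le> e' \<Longrightarrow> pdisc z e \<subseteq> pdisc z e'"
  by (force simp: pdisc_def)

lemma pdisc_open:
  assumes "w \<in> pdisc z e"
  shows "\<exists>d>0. pdisc w d \<subseteq> pdisc z e"
  using assms
proof (induction z arbitrary: w)
  case Nil
  thus ?case by (auto simp: pdisc_def intro: exI[of _ 1])
next
  case (Cons x z)
  then obtain s t where st: "w = s # t" "cmod (s - x) < e" "t \<in> pdisc z e"
    by (auto simp: pdisc_Cons_iff)
  from Cons.IH[OF st(3)] obtain d where d: "d > 0" "pdisc t d \<subseteq> pdisc z e" by blast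
  define d' where "d' = min d (e - cmod (s - x))"
  have "pdisc w d' \<subseteq> pdisc (x # z) e"
  proof
    fix y assume "y \<in> pdisc w d'"
    then obtain s' t' where y: "y = s' # t'" "cmod (s' - s) < d'" "t' \<in> pdisc t d'"
      by (auto simp: pdisc_Cons_iff st)
    have "cmod (s' - x) \<le> cmod (s' - s) + cmod (s - x)"
      using norm_triangle_ineq[of "s' - s" "s - x"] by simp
    moreover have "t' \<in> pdisc t d" using y(3) pdisc_mono[of d' d t] by (auto simp: d'_def)
    ultimately show "y \<in> pdisc (x # z) e" using y d by (auto simp: Cons_in_pdisc d'_def)
  qed
  moreover have "d' > 0" using d st by (auto simp: d'_def)
  ultimately show ?case by blast
qed

lemma iter_ev_pdisc: "e > 0 \<Longrightarrow> iter_ev (\<lambda>t. t \<in> pdisc a e) a"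
proof (induction a)
  case Nil
  thus ?case by (simp add: pdisc_def)
next
  case (Cons a as)
  have "\<forall>\<^sub>F s in at a. s \<in> ball a e"
    using Cons.prems by (intro eventually_at_in_open') auto
  thus ?case using Cons
    by (auto simp: Cons_in_pdisc dist_norm norm_minus_commute elim!: eventually_mono)
qed

lemma iter_ev_imp_ex: "iter_ev P a \<Longrightarrow> \<exists>w. P w"
proof (induction a arbitrary: P)
  case (Cons a as)
  from Cons.prems have "\<exists>s. iter_ev (\<lambda>t. P (s # t)) as"
    by (auto dest!: eventually_happens)
  thus ?case using Cons.IH by blast
qed auto

lemma iter_ev_frequent:
  assumes "iter_ev P a" "e > 0"
  shows "\<exists>w\<in>pdisc a e. P w"
  using iter_ev_imp_ex[OF iter_ev_conj[OF assms(1) iter_ev_pdisc[OF assms(2)]]] by blast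

subsection \<open>Iterated limits\<close>

lemma iter_lim_cong:
  "iter_lim f as c \<Longrightarrow> iter_ev (\<lambda>t. f t = g t) as \<Longrightarrow> iter_lim g as c"
proof (induction as arbitrary: f g c)
  case (Cons a as)
  from Cons.prems obtain h where h: "(h \<longlongrightarrow> c) (at a)"
    "\<forall>\<^sub>F s in at a. iter_lim (\<lambda>t. f (s # t)) as (h s)" by auto
  have "\<forall>\<^sub>F s in at a. iter_lim (\<lambda>t. g (s # t)) as (h s)"
    using h(2) Cons.prems(2)[simplified] by eventually_elim (rule Cons.IH)
  with h show ?case by auto
qed auto

text \<open>Peels off the innermost limit, the only one that the Euler-Maclaurin recursion evaluates
  directly; it has to exist only for generic values of the other variables.\<close>

lemma iter_lim_snoc:
  "iter_ev (\<lambda>s. ((\<lambda>t. f (s @ [t])) \<longlongrightarrow> g s) (at a)) as \<Longrightarrow> iter_lim g as c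
    \<Longrightarrow> iter_lim f (as @ [a]) c"
proof (induction as arbitrary: f g c)
  case Nil
  thus ?case by (auto intro!: exI[of _ "\<lambda>t. f [t]"])
next
  case (Cons x xs)
  from Cons.prems obtain h where h: "(h \<longlongrightarrow> c) (at x)"
    "\<forall>\<^sub>F s in at x. iter_lim (\<lambda>t. g (s # t)) xs (h s)" by auto
  have "\<forall>\<^sub>F s in at x. iter_lim (\<lambda>t. f (s # t)) (xs @ [a]) (h s)"
    using h(2) Cons.prems(1)[simplified] by eventually_elim (rule Cons.IH, auto)
  with h show ?case by auto
qed

lemma iter_lim_add:
  "iter_lim f as c \<Longrightarrow> iter_lim g as d \<Longrightarrow> iter_lim (\<lambda>t. f t + g t) as (c + d)"
proof (induction as arbitrary: f g c d)
  case (Cons a as)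
  from Cons.prems obtain h where h: "(h \<longlongrightarrow> c) (at a)"
    "\<forall>\<^sub>F s in at a. iter_lim (\<lambda>t. f (s # t)) as (h s)" by auto
  from Cons.prems obtain k where k: "(k \<longlongrightarrow> d) (at a)"
    "\<forall>\<^sub>F s in at a. iter_lim (\<lambda>t. g (s # t)) as (k s)" by auto
  have "\<forall>\<^sub>F s in at a. iter_lim (\<lambda>t. f (s # t) + g (s # t)) as (h s + k s)"
    using h(2) k(2) by eventually_elim (rule Cons.IH)
  with tendsto_add[OF h(1) k(1)] show ?case by (auto intro!: exI[of _ "\<lambda>s. h s + k s"])
qed auto

lemma iter_lim_cmult: "iter_lim f as c \<Longrightarrow> iter_lim (\<lambda>t. k * f t) as (k * c)"
proof (induction as arbitrary: f c)
  case (Cons a as)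
  from Cons.prems obtain h where h: "(h \<longlongrightarrow> c) (at a)"
    "\<forall>\<^sub>F s in at a. iter_lim (\<lambda>t. f (s # t)) as (h s)" by auto
  have "\<forall>\<^sub>F s in at a. iter_lim (\<lambda>t. k * f (s # t)) as (k * h s)"
    using h(2) by eventually_elim (rule Cons.IH)
  with tendsto_mult_left[OF h(1)] show ?case by (auto intro!: exI[of _ "\<lambda>s. k * h s"])
qed auto

lemma iter_lim_0: "iter_lim (\<lambda>_. 0) as 0"
  by (induction as) (auto intro!: exI[of _ "\<lambda>_. 0"])

lemma iter_lim_sum:
  "finite A \<Longrightarrow> (\<And>j. j \<in> A \<Longrightarrow> iter_lim (f j) as (c j))
    \<Longrightarrow> iter_lim (\<lambda>t. \<Sum>j\<in>A. f j t) as (\<Sum>j\<in>A. c j)"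
  by (induction A rule: finite_induct) (auto intro: iter_lim_0 iter_lim_add)

text \<open>With the last variable frozen, \<open>merge\<close> acts on the remaining ones as such a
  translation. Iterated limits of merged functions thus reduce to the translation invariance of
  punctured neighbourhoods.\<close>

definition shift_last :: "complex \<Rightarrow> complex list \<Rightarrow> complex list" where
  "shift_last q s = butlast s @ [last s + q]"

lemma shift_last_snoc [simp]: "shift_last q (xs @ [x]) = xs @ [x + q]"
  by (simp add: shift_last_def)

lemma at_shift_complex: "filtermap (\<lambda>x. x + q) (at (a::complex)) = at (a + q)"
  using filtermap_at_shift[of "-q" a] by simp

lemma iter_ev_shift_last:
  "iter_ev P (xs @ [a + q]) \<Longrightarrow> iter_ev (\<lambda>s. P (shift_last q s)) (xs @ [a])"
proof (induction xs arbitrary: P)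
  case Nil
  hence "\<forall>\<^sub>F s in filtermap (\<lambda>x. x + q) (at a). P [s]" by (simp add: at_shift_complex)
  thus ?case by (simp add: eventually_filtermap shift_last_def)
next
  case (Cons x xs)
  have "iter_ev (\<lambda>t. P (shift_last q (s # t))) (xs @ [a])"
    if "iter_ev (\<lambda>t. P (s # t)) (xs @ [a + q])" for s
    using Cons.IH[OF that] by (rule iter_ev_mono) (auto simp: shift_last_def split: if_splits)
  with Cons.prems show ?case by (auto elim: eventually_mono)
qed

lemma iter_lim_shift_last:
  "iter_lim f (xs @ [a + q]) c \<Longrightarrow> iter_lim (\<lambda>s. f (shift_last q s)) (xs @ [a]) c"
proof (induction xs arbitrary: f c)
  case Nil
  then obtain g where g: "(g \<longlongrightarrow> c) (filtermap (\<lambda>x. x + q) (at a))"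
     "\<forall>\<^sub>F s in filtermap (\<lambda>x. x + q) (at a). f [s] = g s" by (auto simp: at_shift_complex)
  thus ?case
    by (auto simp: eventually_filtermap shift_last_def filterlim_filtermap intro!: exI[of _ "\<lambda>x. g (x + q)"])
next
  case (Cons x xs)
  then obtain h where h: "(h \<longlongrightarrow> c) (at x)"
    "\<forall>\<^sub>F s in at x. iter_lim (\<lambda>t. f (s # t)) (xs @ [a + q]) (h s)" by auto
  have "iter_lim (\<lambda>t. f (shift_last q (s # t))) (xs @ [a]) d"
    if "iter_lim (\<lambda>t. f (s # t)) (xs @ [a + q]) d" for s d
    using Cons.IH[OF that]
    by (rule iter_lim_cong) (auto intro!: iter_ev_always simp: shift_last_def split: if_splits)
  with h show ?case by (auto intro!: exI[of _ h] elim: eventually_mono)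
qed

subsection \<open>Separately holomorphic functions\<close>

text \<open>Genericity and the identity theorem work one variable at a time, so this property is
  carried through products, \<open>merge\<close> and \<open>err_sum\<close> by one-variable facts.
  Joint continuity enters through the denominators of the charts of Z, in
  \<open>holo_nonzero_nbhd\<close>.\<close>

definition sep_hol :: "(complex list \<Rightarrow> complex) \<Rightarrow> complex list \<Rightarrow> real \<Rightarrow> bool" where
  "sep_hol f z e \<longleftrightarrow>
     (\<forall>w\<in>pdisc z e. \<forall>i<length z. (\<lambda>t. f (w[i := t])) field_differentiable (at (w ! i)))"

lemma sep_holD:
  "sep_hol f z e \<Longrightarrow> w \<in> pdisc z e \<Longrightarrow> i < length z \<Longrightarrow>
    (\<lambda>t. f (w[i := t])) field_differentiable (at (w ! i))"
  by (auto simp: sep_hol_def)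

lemma sep_hol_if_holo: "holo_on_pdisc f z e \<Longrightarrow> sep_hol f z e"
  by (auto simp: holo_on_pdisc_def sep_hol_def)

lemma sep_hol_subset:
  "sep_hol f z e \<Longrightarrow> pdisc z' e' \<subseteq> pdisc z e \<Longrightarrow> length z' = length z \<Longrightarrow> sep_hol f z' e'"
  by (auto simp: sep_hol_def)

lemma sep_hol_const: "sep_hol (\<lambda>_. c) z e"
  by (auto simp: sep_hol_def)

lemma sep_hol_add: "sep_hol f z e \<Longrightarrow> sep_hol g z e \<Longrightarrow> sep_hol (\<lambda>s. f s + g s) z e"
  by (auto simp: sep_hol_def intro!: field_differentiable_add)

lemma sep_hol_diff: "sep_hol f z e \<Longrightarrow> sep_hol g z e \<Longrightarrow> sep_hol (\<lambda>s. f s - g s) z e"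
  by (auto simp: sep_hol_def intro!: field_differentiable_diff)

lemma sep_hol_mult: "sep_hol f z e \<Longrightarrow> sep_hol g z e \<Longrightarrow> sep_hol (\<lambda>s. f s * g s) z e"
  by (auto simp: sep_hol_def intro!: field_differentiable_mult)

lemma sep_hol_nth:
  assumes "f holomorphic_on UNIV"
  shows "sep_hol (\<lambda>s. f (s ! n)) z e"
  unfolding sep_hol_def
proof (intro ballI allI impI)
  fix w i assume w: "w \<in> pdisc z e" "i < length z"
  have i: "i < length w" using w by (simp add: pdisc_def)
  show "(\<lambda>t. f (w[i := t] ! n)) field_differentiable at (w ! i)"
  proof (cases "i = n")
    case True
    thus ?thesis using assms i by (simp add: holomorphic_on_def)
  qed simp
qed

lemma sep_hol_slice:
  assumes "sep_hol f (z # zs) e" "cmod (s - z) < e"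
  shows "sep_hol (\<lambda>t. f (s # t)) zs e"
  unfolding sep_hol_def
proof (intro ballI allI impI)
  fix w i assume "w \<in> pdisc zs e" "i < length zs"
  thus "(\<lambda>t. f (s # w[i := t])) field_differentiable at (w ! i)"
    using assms(1)[THEN sep_holD, of "s # w" "Suc i"] assms(2) by (simp add: Cons_in_pdisc)
qed

text \<open>Induction on the dimension: the slice in the first variable through w is not identically
  zero, so its zeros are isolated. For every other s near the first coordinate of a, the slice at s
  is nonzero at the tail of w, and the induction hypothesis applies to it.\<close>

lemma iter_ev_nonzero:
  "sep_hol f z e \<Longrightarrow> w \<in> pdisc z e \<Longrightarrow> f w \<noteq> 0 \<Longrightarrow> a \<in> pdisc z e \<Longrightarrow> iter_ev (\<lambda>s. f s \<noteq> 0) a"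
proof (induction z arbitrary: f w a)
  case Nil
  thus ?case by (simp add: pdisc_def)
next
  case (Cons z zs)
  obtain w0 ws where w: "w = w0 # ws" "cmod (w0 - z) < e" "ws \<in> pdisc zs e"
    using Cons.prems by (auto simp: pdisc_Cons_iff)
  obtain a0 as where a: "a = a0 # as" "cmod (a0 - z) < e" "as \<in> pdisc zs e"
    using Cons.prems by (auto simp: pdisc_Cons_iff)
  have "(\<lambda>s. f (s # ws)) holomorphic_on ball z e"
    unfolding holomorphic_on_open[OF open_ball] field_differentiable_def[symmetric]
  proof
    fix x assume "x \<in> ball z e"
    thus "(\<lambda>s. f (s # ws)) field_differentiable (at x)"
      using Cons.prems(1)[THEN sep_holD, of "x # ws" 0] w
      by (simp add: Cons_in_pdisc dist_norm norm_minus_commute)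
  qed
  hence "\<forall>\<^sub>F s in at a0. f (s # ws) \<noteq> 0 \<and> s \<in> ball z e"
    by (rule non_zero_neighbour_alt[where \<beta> = w0 and f = "\<lambda>s. f (s # ws)" and S = "ball z e"])
       (use w a Cons.prems in \<open>auto simp: dist_norm norm_minus_commute\<close>)
  hence "\<forall>\<^sub>F s in at a0. iter_ev (\<lambda>t. f (s # t) \<noteq> 0) as"
  proof eventually_elim
    case (elim s)
    hence "cmod (s - z) < e" by (simp add: dist_norm norm_minus_commute)
    from Cons.IH[OF sep_hol_slice[OF Cons.prems(1) this] w(3) _ a(3)] elim show ?case by simp
  qed
  thus ?case by (simp add: a)
qed

text \<open>If f y were nonzero, f would be nonzero at generic points around w, and some of these
  lie in the polydisc where f vanishes.\<close>

lemma sep_hol_identity: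
  assumes "sep_hol f z e" "w \<in> pdisc z e" "d > 0" "\<And>x. x \<in> pdisc w d \<Longrightarrow> f x = 0"
    and "y \<in> pdisc z e"
  shows "f y = 0"
proof (rule ccontr)
  assume "f y \<noteq> 0"
  from iter_ev_nonzero[OF assms(1) assms(5) this assms(2)] have "iter_ev (\<lambda>s. f s \<noteq> 0) w" .
  from iter_ev_frequent[OF this assms(3)] assms(4) show False by blast
qed

subsection \<open>Meromorphic functions on a polydisc and their comparison\<close>

text \<open>One quotient for the whole polydisc, in contrast to the local charts of
  \<open>meromorphic_Cr\<close>; this is what lets the constructed W serve as a reference across all
  charts of Z.\<close>

definition mer :: "(complex list \<Rightarrow> complex) \<Rightarrow> complex list \<Rightarrow> real \<Rightarrow> bool" where
  "mer W z e \<longleftrightarrow> (\<exists>u v. sep_hol u z e \<and> sep_hol v z e \<and> (\<exists>w\<in>pdisc z e. v w \<noteq> 0) \<and>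
     (\<forall>w\<in>pdisc z e. v w \<noteq> 0 \<longrightarrow> W w = u w / v w))"

text \<open>No zero divisors: at any common point both factors are generically nonzero.\<close>

lemma nonzero_mult:
  assumes "sep_hol u z e" "\<exists>w\<in>pdisc z e. u w \<noteq> 0" "sep_hol v z e" "\<exists>w\<in>pdisc z e. v w \<noteq> 0"
  shows "\<exists>w\<in>pdisc z e. u w * v w \<noteq> 0"
proof -
  obtain a where a: "a \<in> pdisc z e" using assms by auto
  then obtain d where d: "d > 0" "pdisc a d \<subseteq> pdisc z e" using pdisc_open by blast
  have "iter_ev (\<lambda>s. u s \<noteq> 0 \<and> v s \<noteq> 0) a"
    using assms(2,4) iter_ev_nonzero[OF assms(1) _ _ a] iter_ev_nonzero[OF assms(3) _ _ a]
    by (intro iter_ev_conj) blast+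
  from iter_ev_frequent[OF this d(1)] d(2) show ?thesis by auto
qed

lemma mer_divide:
  "sep_hol u z e \<Longrightarrow> sep_hol v z e \<Longrightarrow> \<exists>w\<in>pdisc z e. v w \<noteq> 0 \<Longrightarrow> mer (\<lambda>s. u s / v s) z e"
  by (auto simp: mer_def)

lemma mer_sep_hol: "sep_hol u z e \<Longrightarrow> e > 0 \<Longrightarrow> mer u z e"
  using mer_divide[of u z e "\<lambda>_. 1"] center_in_pdisc[of e z] by (auto intro: sep_hol_const)

lemma mer_add:
  assumes "mer W z e" "mer X z e"
  shows "mer (\<lambda>s. W s + X s) z e"
proof -
  obtain u v where uv: "sep_hol u z e" "sep_hol v z e" "\<exists>w\<in>pdisc z e. v w \<noteq> 0"
     "\<forall>w\<in>pdisc z e. v w \<noteq> 0 \<longrightarrow> W w = u w / v w" using assms(1) unfolding mer_def by blast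
  obtain f g where fg: "sep_hol f z e" "sep_hol g z e" "\<exists>w\<in>pdisc z e. g w \<noteq> 0"
     "\<forall>w\<in>pdisc z e. g w \<noteq> 0 \<longrightarrow> X w = f w / g w" using assms(2) unfolding mer_def by blast
  show ?thesis unfolding mer_def
  proof (intro exI conjI)
    show "sep_hol (\<lambda>s. u s * g s + f s * v s) z e" "sep_hol (\<lambda>s. v s * g s) z e"
      using uv fg by (auto intro!: sep_hol_add sep_hol_mult)
    show "\<exists>w\<in>pdisc z e. v w * g w \<noteq> 0" using uv fg by (intro nonzero_mult)
  qed (use uv fg in \<open>auto simp: add_frac_eq\<close>)
qed

lemma mer_mult:
  assumes "mer W z e" "mer X z e"
  shows "mer (\<lambda>s. W s * X s) z e"
proof -
  obtain u v where uv: "sep_hol u z e" "sep_hol v z e" "\<exists>w\<in>pdisc z e. v w \<noteq> 0"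
     "\<forall>w\<in>pdisc z e. v w \<noteq> 0 \<longrightarrow> W w = u w / v w" using assms(1) unfolding mer_def by blast
  obtain f g where fg: "sep_hol f z e" "sep_hol g z e" "\<exists>w\<in>pdisc z e. g w \<noteq> 0"
     "\<forall>w\<in>pdisc z e. g w \<noteq> 0 \<longrightarrow> X w = f w / g w" using assms(2) unfolding mer_def by blast
  show ?thesis unfolding mer_def
  proof (intro exI conjI)
    show "sep_hol (\<lambda>s. u s * f s) z e" "sep_hol (\<lambda>s. v s * g s) z e"
      using uv fg by (auto intro!: sep_hol_mult)
    show "\<exists>w\<in>pdisc z e. v w * g w \<noteq> 0" using uv fg by (intro nonzero_mult)
  qed (use uv fg in auto)
qed

lemma mer_diff:
  assumes "mer W z e" "mer X z e" "e > 0"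
  shows "mer (\<lambda>s. W s - X s) z e"
  using mer_add[OF assms(1) mer_mult[OF mer_sep_hol[OF sep_hol_const[of "-1"] assms(3)] assms(2)]]
  by simp

lemma mer_sum:
  assumes "finite A" "\<And>j. j \<in> A \<Longrightarrow> mer (f j) z e" "e > 0"
  shows "mer (\<lambda>s. \<Sum>j\<in>A. f j s) z e"
  using assms
  by (induction A rule: finite_induct) (auto intro: mer_sep_hol sep_hol_const mer_add)

section \<open>Merging the last two variables\<close>

definition merge :: "complex \<Rightarrow> complex list \<Rightarrow> complex list" where
  "merge q s = shift_last (last s + q) (butlast s)"

lemma merge_snoc: "merge q (s @ [t]) = shift_last (t + q) s"
  by (simp add: merge_def)

lemma merge_append [simp]: "merge q (xs @ [a, b]) = xs @ [a + b + q]"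
  using shift_last_snoc[of "b + q" xs a] by (simp add: merge_def butlast_append add.assoc)

lemma pdisc_0_iff:
  "w \<in> pdisc (replicate n 0) N \<longleftrightarrow> length w = n \<and> (\<forall>x\<in>set w. cmod x < N)"
  by (auto simp: pdisc_def all_set_conv_all_nth)

lemma length_Suc_Suc_decomp:
  assumes "length w = Suc (Suc n)"
  obtains xs a b where "w = xs @ [a, b]" "length xs = n"
proof -
  obtain y b where y: "w = y @ [b]" using assms by (metis length_Suc_conv_rev)
  then obtain xs a where "y = xs @ [a]" using assms by (metis length_Suc_conv_rev length_append_singleton old.nat.inject)
  with y assms show ?thesis by (intro that[of xs a b]) auto
qed

lemma merge_in_pdisc:
  assumes "w \<in> pdisc (replicate (Suc (Suc n)) 0) N" "2 * N + cmod q \<le> N'"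
  shows "merge q w \<in> pdisc (replicate (Suc n) 0) N'"
proof -
  have w: "length w = Suc (Suc n)" "\<forall>x\<in>set w. cmod x < N" using assms(1) by (auto simp: pdisc_0_iff)
  then obtain xs a b where xs: "w = xs @ [a, b]" "length xs = n" by (elim length_Suc_Suc_decomp)
  have "cmod (a + b + q) \<le> cmod a + cmod b + cmod q"
    using norm_triangle_ineq[of "a + b" q] norm_triangle_ineq[of a b] by linarith
  moreover have "cmod a < N" "cmod b < N" "\<And>x. x \<in> set xs \<Longrightarrow> cmod x < N" using w xs by auto
  moreover have "N \<le> N'" using assms(2) \<open>cmod a < N\<close> norm_ge_zero[of q] norm_ge_zero[of a] by linarith
  ultimately show ?thesis using xs assms(2) unfolding pdisc_0_iff by fastforce
qed

text \<open>In each of the last two variables \<open>merge q\<close> is a translation of the new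
  last coordinate, so differentiability follows by composition. The radius condition bounds a + b +
  q.\<close>

lemma sep_hol_merge:
  assumes f: "sep_hol f (replicate (Suc n) 0) N'" and N: "2 * N + cmod q \<le> N'"
  shows "sep_hol (\<lambda>s. f (merge q s)) (replicate (Suc (Suc n)) 0) N"
  unfolding sep_hol_def
proof (intro ballI allI impI)
  fix w i assume wp: "w \<in> pdisc (replicate (Suc (Suc n)) 0) N"
    and i: "i < length (replicate (Suc (Suc n)) (0::complex))"
  have w: "length w = Suc (Suc n)" using wp by (auto simp: pdisc_0_iff)
  then obtain xs a b where xs: "w = xs @ [a, b]" "length xs = n" by (elim length_Suc_Suc_decomp)
  have "merge q w \<in> pdisc (replicate (Suc n) 0) N'" using merge_in_pdisc[OF wp N] .
  hence p: "xs @ [a + b + q] \<in> pdisc (replicate (Suc n) 0) N'" using xs by simp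
  have D: "(\<lambda>t. f ((xs @ [a + b + q])[j := t])) field_differentiable at ((xs @ [a + b + q]) ! j)"
    if "j \<le> n" for j
    using sep_holD[OF f p, of j] that by simp
  consider "i < n" | "i = n" | "i = Suc n" using i by fastforce
  thus "(\<lambda>t. f (merge q (w[i := t]))) field_differentiable at (w ! i)"
  proof cases
    case 1
    thus ?thesis using D[of i] xs by (simp add: list_update_append nth_append)
  next
    case 2
    have "((\<lambda>t. f (xs @ [t])) \<circ> (\<lambda>t. t + (b + q))) field_differentiable at a"
      using D[of n] xs
      by (intro field_differentiable_compose)
         (auto intro!: derivative_intros simp: list_update_append nth_append add.assoc)
    thus ?thesis using 2 xs by (simp add: list_update_append nth_append o_def add.assoc)
  next
    case 3
    have "((\<lambda>t. f (xs @ [t])) \<circ> (\<lambda>t. a + t + q)) field_differentiable at b"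
      using D[of n] xs
      by (intro field_differentiable_compose)
         (auto intro!: derivative_intros simp: list_update_append nth_append add.assoc)
    thus ?thesis using 3 xs by (simp add: list_update_append nth_append o_def)
  qed
qed

lemma mer_merge:
  assumes W: "mer W (replicate (Suc n) 0) N'" and N: "2 * N + cmod q \<le> N'" "N > 0"
  shows "mer (\<lambda>s. W (merge q s)) (replicate (Suc (Suc n)) 0) N"
proof -
  obtain u v w where uv: "sep_hol u (replicate (Suc n) 0) N'" "sep_hol v (replicate (Suc n) 0) N'"
     "w\<in>pdisc (replicate (Suc n) 0) N'" "v w \<noteq> 0"
     "\<forall>w\<in>pdisc (replicate (Suc n) 0) N'. v w \<noteq> 0 \<longrightarrow> W w = u w / v w"
    using W unfolding mer_def by blast
  \<comment> \<open>The denominator must not vanish identically on the image of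
    \<open>merge q\<close>. The origin is mapped to (0, ..., 0, q), so a point t near it with v t
    nonzero is sought; its preimage with last coordinate 0 stays within radius N.\<close>
  have "replicate n 0 @ [q] \<in> pdisc (replicate (Suc n) 0) N'"
    using N norm_ge_zero[of q] by (auto simp: pdisc_0_iff simp del: norm_ge_zero)
  from iter_ev_frequent[OF iter_ev_nonzero[OF uv(2-4) this] N(2)]
  obtain t where t: "t \<in> pdisc (replicate n 0 @ [q]) N" "v t \<noteq> 0" by blast
  have "length t = Suc n" using t by (auto simp: pdisc_def)
  then obtain xs c where xs: "t = xs @ [c]" "length xs = n" by (metis length_Suc_conv_rev)
  have "cmod (c - q) < N" "\<And>i. i < n \<Longrightarrow> cmod (xs ! i) < N"
  proof -
    show "cmod (c - q) < N" using t(1) xs by (auto simp: pdisc_def nth_append dest!: spec[of _ n])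
    fix i assume "i < n"
    thus "cmod (xs ! i) < N" using t(1) xs by (auto simp: pdisc_def nth_append dest!: spec[of _ i])
  qed
  hence "xs @ [c - q, 0] \<in> pdisc (replicate (Suc (Suc n)) 0) N"
    using xs N by (auto simp: pdisc_0_iff in_set_conv_nth)
  moreover have "v (merge q (xs @ [c - q, 0])) \<noteq> 0" using t xs by simp
  ultimately have "\<exists>w\<in>pdisc (replicate (Suc (Suc n)) 0) N. v (merge q w) \<noteq> 0" by blast
  moreover have "sep_hol (\<lambda>s. u (merge q s)) (replicate (Suc (Suc n)) 0) N"
    "sep_hol (\<lambda>s. v (merge q s)) (replicate (Suc (Suc n)) 0) N"
    using uv by (auto intro!: sep_hol_merge[OF _ N(1)])
  ultimately show ?thesis
    unfolding mer_def using uv(5) merge_in_pdisc[OF _ N(1)] by blast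
qed

text \<open>The denominator is generically nonzero, and there the quotient is continuous in the last
  variable. Continuity at the point itself, not only a limit, turns the innermost limit of the
  recursion into a substitution.\<close>

lemma mer_isCont_last:
  assumes W: "mer W (replicate (Suc n) 0) N" and as: "as \<in> pdisc (replicate (Suc n) 0) N"
  shows "iter_ev (\<lambda>s. isCont (\<lambda>x. W (butlast s @ [x])) (last s)) as"
proof -
  obtain u v w where uv: "sep_hol u (replicate (Suc n) 0) N" "sep_hol v (replicate (Suc n) 0) N"
     "w\<in>pdisc (replicate (Suc n) 0) N" "v w \<noteq> 0"
     "\<forall>w\<in>pdisc (replicate (Suc n) 0) N. v w \<noteq> 0 \<longrightarrow> W w = u w / v w"
    using W unfolding mer_def by blast
  obtain d where d: "d > 0" "pdisc as d \<subseteq> pdisc (replicate (Suc n) 0) N"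
    using pdisc_open[OF as] by blast
  have "iter_ev (\<lambda>s. v s \<noteq> 0 \<and> s \<in> pdisc as d) as"
    using iter_ev_nonzero[OF uv(2-4) as] iter_ev_pdisc[OF d(1)] by (rule iter_ev_conj)
  thus ?thesis
  proof (rule iter_ev_mono, elim conjE)
    fix s assume s: "v s \<noteq> 0" "s \<in> pdisc as d"
    hence sp: "s \<in> pdisc (replicate (Suc n) 0) N" using d by blast
    then obtain xs c where xs: "s = xs @ [c]" "length xs = n"
      by (metis length_Suc_conv_rev length_in_pdisc length_replicate)
    have f: "isCont (\<lambda>x. f (xs @ [x])) c" if "sep_hol f (replicate (Suc n) 0) N" for f
      using sep_holD[OF that sp, of n] xs
      by (intro field_differentiable_imp_continuous_at) (auto simp: list_update_append nth_append)
    have "\<forall>\<^sub>F x in nhds c. v (xs @ [x]) \<noteq> 0"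
    proof -
      have "((\<lambda>x. v (xs @ [x])) \<longlongrightarrow> v (xs @ [c])) (at c)"
        using f[OF uv(2)] by (simp add: isCont_def)
      hence "\<forall>\<^sub>F x in at c. v (xs @ [x]) \<noteq> 0"
        by (rule tendsto_imp_eventually_ne) (use s xs in auto)
      thus ?thesis using s xs by (simp add: eventually_nhds_conv_at)
    qed
    moreover have "\<forall>\<^sub>F x in nhds c. x \<in> ball 0 N"
      using sp xs by (intro eventually_nhds_in_open) (auto simp: pdisc_0_iff)
    ultimately have "\<forall>\<^sub>F x in nhds c. W (xs @ [x]) = u (xs @ [x]) / v (xs @ [x])"
      by eventually_elim (use uv(5) sp xs in \<open>auto simp: pdisc_0_iff\<close>)
    moreover have "isCont (\<lambda>x. u (xs @ [x]) / v (xs @ [x])) c"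
      using f[OF uv(1)] f[OF uv(2)] s xs by (intro continuous_intros) auto
    ultimately show "isCont (\<lambda>x. W (butlast s @ [x])) (last s)"
      using xs by (simp add: isCont_cong)
  qed
qed

text \<open>Joint continuity provides a whole polydisc on which Z equals its local quotient;
  genericity alone gives points, not an open set.\<close>

lemma holo_nonzero_nbhd:
  assumes "holo_on_pdisc g z e" "w \<in> pdisc z e" "g w \<noteq> 0"
  obtains d where "d > 0" "pdisc w d \<subseteq> pdisc z e" "\<And>x. x \<in> pdisc w d \<Longrightarrow> g x \<noteq> 0"
proof -
  obtain d1 where d1: "d1 > 0" "pdisc w d1 \<subseteq> pdisc z e" using pdisc_open[OF assms(2)] by blast
  obtain d2 where d2: "d2 > 0" "\<And>v. v \<in> pdisc z e \<Longrightarrow> (\<forall>i<length z. cmod (v ! i - w ! i) < d2) \<Longrightarrow>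
      cmod (g v - g w) < cmod (g w)"
    using assms unfolding holo_on_pdisc_def by (meson zero_less_norm_iff)
  show ?thesis
  proof (rule that[of "min d1 d2"])
    show "pdisc w (min d1 d2) \<subseteq> pdisc z e" using d1 pdisc_mono[of "min d1 d2" d1 w] by auto
    fix x assume x: "x \<in> pdisc w (min d1 d2)"
    hence "x \<in> pdisc w d1" using pdisc_mono[of "min d1 d2" d1 w] by auto
    moreover have "\<forall>i<length z. cmod (x ! i - w ! i) < d2"
      using x length_in_pdisc[OF assms(2)] by (auto simp: pdisc_def)
    ultimately show "g x \<noteq> 0" using d2(2)[of x] d1 by auto
  qed (use d1 d2 in auto)
qed

lemma holo_on_pdisc_subset:
  assumes "holo_on_pdisc f z e" "pdisc z' e' \<subseteq> pdisc z e" "length z' = length z"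
  shows "holo_on_pdisc f z' e'"
proof -
  have "\<exists>\<delta>>0. \<forall>v\<in>pdisc z' e'. (\<forall>i<length z'. cmod (v ! i - w ! i) < \<delta>) \<longrightarrow> cmod (f v - f w) < \<epsilon>"
    if "w \<in> pdisc z' e'" "\<epsilon> > 0" for w \<epsilon>
    using assms that unfolding holo_on_pdisc_def by (metis subsetD)
  thus ?thesis using assms unfolding holo_on_pdisc_def by auto
qed

text \<open>Within one chart, cross-multiplication turns equality of the two quotients into the
  vanishing of a separately holomorphic function, to which the identity theorem applies.\<close>

lemma chart_agree:
  assumes f: "sep_hol f p e" and g: "holo_on_pdisc g p e" and g0: "\<exists>w\<in>pdisc p e. g w \<noteq> 0"
    and Z: "\<forall>w\<in>pdisc p e. g w \<noteq> 0 \<longrightarrow> Z w = f w / g w"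
    and u: "sep_hol u p e" and v: "sep_hol v p e"
    and w: "w \<in> pdisc p e" "d > 0" "pdisc w d \<subseteq> pdisc p e"
    and ag: "\<And>x. x \<in> pdisc w d \<Longrightarrow> v x \<noteq> 0 \<Longrightarrow> Z x = u x / v x"
    and x: "x \<in> pdisc p e" "g x \<noteq> 0" "v x \<noteq> 0"
  shows "Z x = u x / v x"
proof -
  have "iter_ev (\<lambda>s. g s \<noteq> 0) w"
    using g0 w(1) iter_ev_nonzero[OF sep_hol_if_holo[OF g]] by blast
  then obtain y where y: "y \<in> pdisc w d" "g y \<noteq> 0" using iter_ev_frequent w(2) by blast
  obtain d1 where d1: "d1 > 0" "pdisc y d1 \<subseteq> pdisc p e" "\<And>x. x \<in> pdisc y d1 \<Longrightarrow> g x \<noteq> 0"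
    using holo_nonzero_nbhd[OF g _ y(2)] w y by blast
  obtain d2 where d2: "d2 > 0" "pdisc y d2 \<subseteq> pdisc w d" using pdisc_open[OF y(1)] by blast
  \<comment> \<open>The extra factor v makes h vanish at the zeros of v too, where the agreement
    says nothing.\<close>
  define h where "h = (\<lambda>x. (f x * v x - u x * g x) * v x)"
  have h: "sep_hol h p e" unfolding h_def
    using f u v sep_hol_if_holo[OF g] by (intro sep_hol_mult sep_hol_diff)
  have "h x = 0"
  proof (rule sep_hol_identity[OF h _ _ _ x(1)])
    show "y \<in> pdisc p e" using y w by blast
    show "min d1 d2 > 0" using d1 d2 by simp
    fix s assume "s \<in> pdisc y (min d1 d2)"
    hence s: "s \<in> pdisc y d1" "s \<in> pdisc y d2"
      using pdisc_mono[of "min d1 d2" d1 y] pdisc_mono[of "min d1 d2" d2 y] by auto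
    show "h s = 0"
    proof (cases "v s = 0")
      case False
      have "Z s = u s / v s" using ag[OF _ False] s d2 by auto
      moreover have "Z s = f s / g s" "g s \<noteq> 0" using Z s d1 by auto
      ultimately show ?thesis using False by (auto simp: h_def field_simps)
    qed (simp add: h_def)
  qed
  hence "f x * v x = u x * g x" using x by (simp add: h_def)
  thus ?thesis using x Z by (simp add: frac_eq_eq)
qed

text \<open>Overlapping charts along the segment from \<open>z\<close> to \<open>a\<close> propagate the agreement.\<close>

lemma meromorphic_transfer:
  assumes Z: "meromorphic_Cr r Z" and W: "mer W (replicate r 0) N"
    and z: "z \<in> pdisc (replicate r 0) N" "e > 0"
    and ZW: "\<And>s. s \<in> pdisc z e \<Longrightarrow> s \<in> pdisc (replicate r 0) N \<Longrightarrow> Z s = W s"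
    and a: "a \<in> pdisc (replicate r 0) N"
  shows "iter_ev (\<lambda>s. Z s = W s) a"
proof -
  let ?U = "pdisc (replicate r 0) N"
  obtain u v w0 where uv: "sep_hol u (replicate r 0) N" "sep_hol v (replicate r 0) N"
     "w0 \<in> ?U" "v w0 \<noteq> 0" "\<forall>w\<in>?U. v w \<noteq> 0 \<longrightarrow> W w = u w / v w"
    using W unfolding mer_def by blast
  have len: "length x = r" if "x \<in> ?U" for x using that by (simp add: pdisc_0_iff)
  have chart: "\<exists>e f g. e > 0 \<and> pdisc p e \<subseteq> ?U \<and> holo_on_pdisc f p e \<and> holo_on_pdisc g p e \<and>
      (\<exists>w\<in>pdisc p e. g w \<noteq> 0) \<and> (\<forall>w\<in>pdisc p e. g w \<noteq> 0 \<longrightarrow> Z w = f w / g w)"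
    if p: "p \<in> ?U" for p
  proof -
    obtain e1 f g w where fg: "e1 > 0" "holo_on_pdisc f p e1" "holo_on_pdisc g p e1"
      "w\<in>pdisc p e1" "g w \<noteq> 0" "\<forall>w\<in>pdisc p e1. g w \<noteq> 0 \<longrightarrow> Z w = f w / g w"
      using Z len[OF p] unfolding meromorphic_Cr_def by blast
    obtain d where d: "d > 0" "pdisc p d \<subseteq> ?U" using pdisc_open[OF p] by blast
    define e where "e = min e1 d"
    have e: "e > 0" "pdisc p e \<subseteq> pdisc p e1" "pdisc p e \<subseteq> ?U"
      using d fg(1) pdisc_mono[of e e1 p] pdisc_mono[of e d p] by (auto simp: e_def)
    have "\<exists>w\<in>pdisc p e. g w \<noteq> 0"
      using iter_ev_frequent[OF iter_ev_nonzero[OF sep_hol_if_holo[OF fg(3)] fg(4,5)] e(1)]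
        center_in_pdisc[OF fg(1)] by blast
    thus ?thesis using e fg holo_on_pdisc_subset[OF _ e(2)] by blast
  qed
  \<comment> \<open>Agreement on polydiscs arbitrarily close to p rather than around p: the point p
    may be a zero of the chart denominator, and Z is arbitrary on that zero set.\<close>
  define agree where "agree p \<longleftrightarrow> (\<forall>d>0. \<exists>w \<rho>. \<rho> > 0 \<and> w \<in> pdisc p d \<and> pdisc w \<rho> \<subseteq> pdisc p d \<and>
      (\<forall>x\<in>pdisc w \<rho>. v x \<noteq> 0 \<longrightarrow> Z x = u x / v x))" for p
  have agree_chart: "Z x = u x / v x"
    if fg: "pdisc p e \<subseteq> ?U" "p \<in> ?U" "holo_on_pdisc f p e" "holo_on_pdisc g p e" "\<exists>w\<in>pdisc p e. g w \<noteq> 0"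
      "\<forall>w\<in>pdisc p e. g w \<noteq> 0 \<longrightarrow> Z w = f w / g w" and y: "y \<in> pdisc p e" "agree y"
      and x: "x \<in> pdisc p e" "g x \<noteq> 0" "v x \<noteq> 0" for p e f g x y
  proof -
    obtain d where d: "d > 0" "pdisc y d \<subseteq> pdisc p e" using pdisc_open[OF y(1)] by blast
    obtain w \<rho> where w: "\<rho> > 0" "w \<in> pdisc y d" "pdisc w \<rho> \<subseteq> pdisc y d"
      "\<forall>x\<in>pdisc w \<rho>. v x \<noteq> 0 \<longrightarrow> Z x = u x / v x" using y(2) d(1) unfolding agree_def by blast
    have l: "length p = length (replicate r (0::complex))" using len[OF fg(2)] by simp
    show ?thesis
      by (rule chart_agree[OF sep_hol_if_holo[OF fg(3)] fg(4,5,6) sep_hol_subset[OF uv(1) fg(1) l]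
            sep_hol_subset[OF uv(2) fg(1) l], of w \<rho>]) (use w d x in auto)
  qed
  define p where "p = (\<lambda>t::real. map (\<lambda>i. z ! i + of_real t * (a ! i - z ! i)) [0..<r])"
  have p_in: "p t \<in> ?U" if "t \<in> {0..1}" for t
  proof -
    have "cmod (z ! i + of_real t * (a ! i - z ! i)) < N" if "i < r" for i
    proof -
      have "z ! i \<in> ball 0 N" "a ! i \<in> ball 0 N"
        using z a that by (auto simp: pdisc_0_iff)
      hence "(1 - t) *\<^sub>R (z ! i) + t *\<^sub>R (a ! i) \<in> ball 0 N"
        using \<open>t \<in> {0..1}\<close> convex_ball[of "0::complex" N] unfolding convex_alt by simp
      moreover have "(1 - t) *\<^sub>R (z ! i) + t *\<^sub>R (a ! i) = z ! i + of_real t * (a ! i - z ! i)"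
        by (simp add: scaleR_conv_of_real algebra_simps)
      ultimately show ?thesis by simp
    qed
    thus ?thesis by (auto simp: p_def pdisc_0_iff)
  qed
  have p01: "p 0 = z" "p 1 = a" using len[OF z(1)] len[OF a] by (auto simp: p_def intro: nth_equalityI)
  have "agree (p 1)"
  proof (rule connected_induction_simple[of "{0..1::real}" 0 1 "\<lambda>t. agree (p t)"])
    show "agree (p 0)" unfolding agree_def p01
    proof (intro allI impI)
      fix d :: real assume "d > 0"
      obtain d' where d': "d' > 0" "pdisc z d' \<subseteq> ?U" using pdisc_open[OF z(1)] by blast
      define \<rho> where "\<rho> = min d (min d' e)"
      have \<rho>: "\<rho> > 0" "pdisc z \<rho> \<subseteq> pdisc z d" "pdisc z \<rho> \<subseteq> pdisc z e" "pdisc z \<rho> \<subseteq> ?U"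
        using d' \<open>d > 0\<close> z(2) pdisc_mono[of \<rho> d z] order.trans[OF pdisc_mono[of \<rho> d' z] d'(2)]
          pdisc_mono[of \<rho> e z] by (auto simp: \<rho>_def)
      have "\<forall>x\<in>pdisc z \<rho>. v x \<noteq> 0 \<longrightarrow> Z x = u x / v x" using \<rho> ZW uv(5) by (metis subsetD)
      thus "\<exists>w \<rho>. \<rho> > 0 \<and> w \<in> pdisc z d \<and> pdisc w \<rho> \<subseteq> pdisc z d \<and>
          (\<forall>x\<in>pdisc w \<rho>. v x \<noteq> 0 \<longrightarrow> Z x = u x / v x)"
        using \<rho> center_in_pdisc[OF \<open>d > 0\<close>] by blast
    qed
  next
    fix t0 :: real assume t0: "t0 \<in> {0..1}"
    obtain e f g where fg: "e > 0" "pdisc (p t0) e \<subseteq> ?U" "holo_on_pdisc f (p t0) e"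
      "holo_on_pdisc g (p t0) e" "\<exists>w\<in>pdisc (p t0) e. g w \<noteq> 0"
      "\<forall>w\<in>pdisc (p t0) e. g w \<noteq> 0 \<longrightarrow> Z w = f w / g w" using chart[OF p_in[OF t0]] by metis
    \<comment> \<open>The parameters whose points lie in the chart at \<open>p t0\<close>. One
      agreeing point in the chart forces agreement throughout it, hence near each of its other
      points.\<close>
    define T where "T = {t. p t \<in> pdisc (p t0) e}"
    have "T = (\<Inter>i\<in>{..<r}. {t. cmod ((z ! i + of_real t * (a ! i - z ! i)) - p t0 ! i) < e})"
      by (auto simp: T_def pdisc_def p_def)
    also have "open \<dots>" by (intro open_INT open_Collect_less continuous_intros ballI) auto
    finally have "openin (top_of_set {0..1}) ({0..1} \<inter> T)" by (intro openin_open_Int)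
    moreover have "t0 \<in> T" using fg(1) by (simp add: T_def center_in_pdisc)
    moreover have "agree (p y)" if "x \<in> {0..1} \<inter> T" "y \<in> {0..1} \<inter> T" "agree (p x)" for x y
      unfolding agree_def
    proof (intro allI impI)
      fix d :: real assume d: "d > 0"
      have px: "p x \<in> pdisc (p t0) e" and py: "p y \<in> pdisc (p t0) e" using that by (auto simp: T_def)
      \<comment> \<open>A point close to \<open>p y\<close> off the zero set of g is needed: around
        it Z is the quotient f / g, so the agreement fills a polydisc.\<close>
      have "iter_ev (\<lambda>s. g s \<noteq> 0) (p y)"
        using fg(5) iter_ev_nonzero[OF sep_hol_if_holo[OF fg(4)] _ _ py] by blast
      moreover obtain d' where d': "d' > 0" "pdisc (p y) d' \<subseteq> pdisc (p t0) e"
        using pdisc_open[OF py] by blast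
      ultimately obtain w where w: "w \<in> pdisc (p y) (min d d')" "g w \<noteq> 0"
        using iter_ev_frequent[of _ "p y" "min d d'"] d by auto
      have w': "w \<in> pdisc (p y) d" "w \<in> pdisc (p t0) e"
        using w(1) d' pdisc_mono[of "min d d'" d "p y"] pdisc_mono[of "min d d'" d' "p y"] by auto
      obtain d1 where d1: "d1 > 0" "pdisc w d1 \<subseteq> pdisc (p t0) e" "\<And>x. x \<in> pdisc w d1 \<Longrightarrow> g x \<noteq> 0"
        using holo_nonzero_nbhd[OF fg(4) w'(2) w(2)] by blast
      obtain d2 where d2: "d2 > 0" "pdisc w d2 \<subseteq> pdisc (p y) d" using pdisc_open[OF w'(1)] by blast
      define \<rho> where "\<rho> = min d1 d2"
      have \<rho>: "\<rho> > 0" "pdisc w \<rho> \<subseteq> pdisc w d1" "pdisc w \<rho> \<subseteq> pdisc w d2"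
        using d1 d2 pdisc_mono[of \<rho> d1 w] pdisc_mono[of \<rho> d2 w] by (auto simp: \<rho>_def)
      have "Z s = u s / v s" if "s \<in> pdisc w \<rho>" "v s \<noteq> 0" for s
        using agree_chart[OF fg(2) p_in[OF t0] fg(3-6) px \<open>agree (p x)\<close>, of s] that \<rho> d1 by blast
      thus "\<exists>w \<rho>. \<rho> > 0 \<and> w \<in> pdisc (p y) d \<and> pdisc w \<rho> \<subseteq> pdisc (p y) d \<and>
          (\<forall>x\<in>pdisc w \<rho>. v x \<noteq> 0 \<longrightarrow> Z x = u x / v x)"
        using \<rho> d2 w' by blast
    qed
    ultimately show "\<exists>T. openin (top_of_set {0..1}) T \<and> t0 \<in> T \<and>
        (\<forall>x\<in>T. \<forall>y\<in>T. agree (p x) \<longrightarrow> agree (p y))"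
      using t0 by (intro exI[of _ "{0..1} \<inter> T"]) blast
  qed auto
  hence ag: "agree a" using p01 by simp
  obtain e f g where fg: "e > 0" "pdisc a e \<subseteq> ?U" "holo_on_pdisc f a e"
      "holo_on_pdisc g a e" "\<exists>w\<in>pdisc a e. g w \<noteq> 0"
      "\<forall>w\<in>pdisc a e. g w \<noteq> 0 \<longrightarrow> Z w = f w / g w" using chart[OF a] by metis
  have "iter_ev (\<lambda>s. g s \<noteq> 0) a"
    using fg(5) iter_ev_nonzero[OF sep_hol_if_holo[OF fg(4)] _ _ center_in_pdisc[OF fg(1)]] by blast
  moreover have "iter_ev (\<lambda>s. v s \<noteq> 0) a" by (rule iter_ev_nonzero[OF uv(2-4) a])
  moreover have "iter_ev (\<lambda>s. s \<in> pdisc a e) a" by (rule iter_ev_pdisc[OF fg(1)])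
  ultimately have "iter_ev (\<lambda>s. g s \<noteq> 0 \<and> v s \<noteq> 0 \<and> s \<in> pdisc a e) a"
    by (intro iter_ev_conj)
  thus ?thesis
  proof (rule iter_ev_mono, elim conjE)
    fix s assume s: "g s \<noteq> 0" "v s \<noteq> 0" "s \<in> pdisc a e"
    have "Z s = u s / v s"
      using agree_chart[OF fg(2) a fg(3-6) center_in_pdisc[OF fg(1)] ag s(3,1,2)] .
    thus "Z s = W s" using uv(5) s fg(2) by auto
  qed
qed

subsection \<open>Bernoulli numbers\<close>

lemma bernoulli_num_0 [simp]: "bernoulli_num 0 = 1"
  by (subst bernoulli_num.simps) simp

lemma bernoulli_num_1 [simp]: "bernoulli_num (Suc 0) = - 1 / 2"
  by (subst bernoulli_num.simps) simp

text \<open>The top term j = n contributes B_n and the recurrence annihilates the others, except for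
  n = 1, where B_0 = 1 remains.\<close>

lemma bernoulli_num_sum:
  "(\<Sum>j\<le>n. of_nat (n choose j) * bernoulli_num j) = bernoulli_num n + (if n = 1 then 1 else 0)"
proof (cases n)
  case (Suc m)
  have "(\<Sum>j<Suc m. of_nat (Suc m choose j) * bernoulli_num j) = (if m = 0 then 1 else 0)"
  proof (cases "m = 0")
    case False
    have "of_nat (Suc m) * bernoulli_num m = - (\<Sum>j<m. of_nat (Suc m choose j) * bernoulli_num j)"
      using False by (subst bernoulli_num.simps) (simp add: field_simps del: of_nat_Suc)
    thus ?thesis using False by (simp del: of_nat_Suc)
  qed simp
  thus ?thesis using Suc by (simp add: lessThan_Suc_atMost[symmetric] del: sum.lessThan_Suc of_nat_Suc)
     (simp add: atLeast0AtMost)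
qed simp

text \<open>For B(X) = X / (e^X - 1) this is the identity B(-X) = B(X) + X. Both sides agree after
  multiplication by e^X - 1, which cancels among formal power series.\<close>

lemma bernoulli_num_neg: "(-1) ^ n * bernoulli_num n = bernoulli_num n + (if n = 1 then 1 else 0)"
proof -
  define B where "B = Abs_fps (\<lambda>n. bernoulli_num n / fact n)"
  have BE: "B * fps_exp 1 = B + fps_X"
  proof (rule fps_ext)
    fix n
    have "(B * fps_exp 1) $ n = (\<Sum>j\<le>n. bernoulli_num j / fact j * (1 / fact (n - j)))"
      by (simp add: B_def fps_mult_nth atLeast0AtMost)
    also have "\<dots> = (\<Sum>j\<le>n. of_nat (n choose j) * bernoulli_num j) / fact n"
      unfolding sum_divide_distrib by (intro sum.cong) (auto simp: binomial_fact)
    also have "\<dots> = (B + fps_X) $ n"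
      by (subst bernoulli_num_sum) (auto simp: B_def add_divide_distrib)
    finally show "(B * fps_exp 1) $ n = (B + fps_X) $ n" .
  qed
  define G where "G = fps_compose B (- fps_X)"
  have GE: "G * fps_exp (-1) = G - fps_X"
  proof -
    have "fps_compose (B * fps_exp 1) (- fps_X) = fps_compose (B + fps_X) (- fps_X)" by (simp add: BE)
    thus ?thesis by (simp add: fps_compose_mult_distrib fps_compose_add_distrib G_def)
  qed
  have "fps_exp (-1) * fps_exp 1 = (1 :: complex fps)" using fps_exp_add_mult[of "-1" "1::complex"] by simp
  hence "G = (G - fps_X) * fps_exp 1" by (simp add: GE[symmetric] mult.assoc)
  hence "G * (fps_exp 1 - 1) = fps_X * fps_exp 1" by (simp add: algebra_simps)
  also have "\<dots> = (B * (fps_exp 1 - 1)) * fps_exp 1" by (simp add: BE right_diff_distrib)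
  also have "\<dots> = (B + fps_X) * (fps_exp 1 - 1)" by (simp add: BE[symmetric] mult_ac)
  finally have "G = B + fps_X"
  proof -
    assume "G * (fps_exp 1 - 1) = (B + fps_X) * (fps_exp 1 - 1)"
    moreover have "(fps_exp 1 - 1 :: complex fps) $ 1 \<noteq> 0" by simp
    hence "(fps_exp 1 - 1 :: complex fps) \<noteq> 0" by (metis fps_zero_nth)
    ultimately show ?thesis by simp
  qed
  hence "G $ n = (B + fps_X) $ n" by simp
  moreover have "G $ n = (-1) ^ n * (bernoulli_num n / fact n)"
    unfolding G_def by (subst fps_compose_uminus') (simp add: B_def)
  ultimately show ?thesis by (auto simp: B_def field_simps split: if_splits)
qed

subsection \<open>Euler--Maclaurin summation\<close>

text \<open>The approximation to the sum of n^(-s) over n > m. For j \<ge> 1 the quotient of the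
  Pochhammer symbol by s - 1 is (s)_(j-1), so the pole at s = 1 comes from j = 0 alone.\<close>

definition em_poly :: "nat \<Rightarrow> complex \<Rightarrow> nat \<Rightarrow> complex" where
  "em_poly J s m = (\<Sum>j\<le>J. bernoulli_num j / fact j * pochhammer (s - 1) j / (s - 1)
                       * of_nat m powr (1 - s - of_nat j))"

text \<open>The coefficient of x^n in e^x times the Taylor polynomial of degree J of x / (e^x - 1).
  It appears when (m - 1)^(1 - s - j) is expanded in powers of 1 / m and equal exponents are
  collected over j.\<close>

definition em_beta :: "nat \<Rightarrow> nat \<Rightarrow> complex" where
  "em_beta J n = (\<Sum>j\<le>J. if n < j then 0 else bernoulli_num j / (fact j * fact (n - j)))"

text \<open>Terms of the binomial expansion of \<open>em_poly J s (m - 1) - em_poly J s m - m powr - s\<close> in powers of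
  \<open>1 / m\<close>; unlike that difference, the expansion has no singularity at \<open>s = 1\<close>.\<close>

definition em_term :: "nat \<Rightarrow> complex \<Rightarrow> nat \<Rightarrow> nat \<Rightarrow> complex" where
  "em_term J s m i = pochhammer s (J + i) * em_beta J (Suc (J + i)) * of_nat m powr (- s - of_nat (J + i))"

definition em_err :: "nat \<Rightarrow> complex \<Rightarrow> nat \<Rightarrow> complex" where
  "em_err J s m = (\<Sum>\<^sub>\<infinity>i. em_term J s m i)"

lemma norm_nat_powr: "norm (of_nat m powr s :: complex) = real m powr Re s"
  by (cases "m = 0") (simp_all add: norm_powr_real_powr)

text \<open>Up to degree J the truncation is not felt, and e^x x / (e^x - 1) = x / (e^x - 1) +
  x.\<close>

lemma em_beta_le:
  assumes "n \<le> J"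
  shows "em_beta J n = (bernoulli_num n + (if n = 1 then 1 else 0)) / fact n"
proof -
  have "em_beta J n = (\<Sum>j\<le>n. bernoulli_num j / (fact j * fact (n - j)))"
    unfolding em_beta_def using assms by (intro sum.mono_neutral_cong_right) auto
  also have "\<dots> = (\<Sum>j\<le>n. of_nat (n choose j) * bernoulli_num j) / fact n"
    unfolding sum_divide_distrib by (intro sum.cong) (auto simp: binomial_fact)
  finally show ?thesis by (simp add: bernoulli_num_sum)
qed

text \<open>The binomial series of (m - 1)^(-a - j), indexed by the total degree n = i + j. The
  factor \<open>pochhammer a j\<close> joins that of the series to form
  \<open>pochhammer a n\<close>, so that terms for different j can be collected; m \<ge> 2 gives
  convergence.\<close>

lemma binomial_pred_sums:
  fixes a :: complex
  assumes "m \<ge> 2"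
  shows "(\<lambda>n. if n < j then 0 else pochhammer a n / fact (n - j) * of_nat m powr (- a - of_nat n)) sums
     (pochhammer a j * of_nat (m - 1) powr (- a - of_nat j))"
proof -
  let ?f = "\<lambda>n. if n < j then 0 else pochhammer a n / fact (n - j) * of_nat m powr (- a - of_nat n) :: complex"
  have "(\<lambda>i. pochhammer a j * ((- a - of_nat j gchoose i) * of_real (real m) powr (- a - of_nat j - of_nat i)
            * of_real (- 1) ^ i)) sums
          (pochhammer a j * of_real (real m + (- 1)) powr (- a - of_nat j))"
    using assms by (intro sums_mult gen_binomial_complex'') auto
  also have "(\<lambda>i. pochhammer a j * ((- a - of_nat j gchoose i) * of_real (real m) powr (- a - of_nat j - of_nat i)
            * of_real (- 1) ^ i)) = (\<lambda>i. ?f (i + j))"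
  proof
    fix i
    have "pochhammer a (i + j) = pochhammer a j * pochhammer (a + of_nat j) i"
      by (simp only: add.commute[of i j] pochhammer_product')
    moreover have "(-1) ^ i * (-1) ^ i = (1::complex)" by (simp flip: power_mult_distrib)
    ultimately show "pochhammer a j * ((- a - of_nat j gchoose i) * of_real (real m) powr (- a - of_nat j - of_nat i)
            * of_real (- 1) ^ i) = ?f (i + j)"
      by (simp add: gbinomial_pochhammer algebra_simps)
  qed
  also have "of_real (real m + (- 1)) = (of_nat (m - 1) :: complex)"
    using assms by (simp add: of_nat_diff)
  finally show ?thesis by (subst (asm) sums_iff_shift) simp
qed

lemma em_step_sums:
  assumes "s \<noteq> 1" "m \<ge> 2" "J \<ge> 1"
  shows "em_term J s m sums (em_poly J s (m - 1) - em_poly J s m - of_nat m powr (- s))"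
proof -
  let ?g = "\<lambda>n. pochhammer (s - 1) n * of_nat m powr (1 - s - of_nat n)"
  have "(\<lambda>n. \<Sum>j\<le>J. bernoulli_num j / fact j * (if n < j then 0 else
           pochhammer (s - 1) n / fact (n - j) * of_nat m powr (- (s - 1) - of_nat n))) sums
         (\<Sum>j\<le>J. bernoulli_num j / fact j * (pochhammer (s - 1) j * of_nat (m - 1) powr (- (s - 1) - of_nat j)))"
    using assms by (intro sums_sum sums_mult binomial_pred_sums)
  also have "(\<lambda>n. \<Sum>j\<le>J. bernoulli_num j / fact j * (if n < j then 0 else
           pochhammer (s - 1) n / fact (n - j) * of_nat m powr (- (s - 1) - of_nat n)))
        = (\<lambda>n. em_beta J n * ?g n)"
    unfolding em_beta_def sum_distrib_right by (intro ext sum.cong) auto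
  also have "(\<Sum>j\<le>J. bernoulli_num j / fact j * (pochhammer (s - 1) j * of_nat (m - 1) powr (- (s - 1) - of_nat j)))
       = (s - 1) * em_poly J s (m - 1)"
    unfolding em_poly_def sum_distrib_left using assms by (intro sum.cong) (auto simp: field_simps)
  finally have "(\<lambda>i. em_beta J (i + Suc J) * ?g (i + Suc J)) sums
      ((s - 1) * em_poly J s (m - 1) - (\<Sum>n<Suc J. em_beta J n * ?g n))"
    by (subst sums_iff_shift) simp
  \<comment> \<open>The coefficients up to degree J are exact: they reproduce
    \<open>em_poly J s m\<close>, and the correction at n = 1 yields the summand m^(-s). The terms
    with n > J are the error.\<close>
  also have "(\<Sum>n<Suc J. em_beta J n * ?g n) =
      (\<Sum>n<Suc J. bernoulli_num n / fact n * ?g n + (if n = 1 then (s - 1) * of_nat m powr (- s) else 0))"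
    by (intro sum.cong) (auto simp: em_beta_le field_simps)
  also have "\<dots> = (\<Sum>n\<le>J. bernoulli_num n / fact n * ?g n) + (s - 1) * of_nat m powr (- s)"
    using assms by (subst sum.distrib) (simp add: lessThan_Suc_atMost)
  also have "(\<Sum>n\<le>J. bernoulli_num n / fact n * ?g n) = (s - 1) * em_poly J s m"
    unfolding em_poly_def sum_distrib_left using assms by (intro sum.cong) (auto simp: field_simps)
  also have "(s - 1) * em_poly J s (m - 1) - ((s - 1) * em_poly J s m + (s - 1) * of_nat m powr - s)
    = (s - 1) * (em_poly J s (m - 1) - em_poly J s m - of_nat m powr (- s))"
    by (simp add: algebra_simps)
  also have "(\<lambda>i. em_beta J (i + Suc J) * ?g (i + Suc J)) = (\<lambda>i. (s - 1) * em_term J s m i)"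
    by (simp add: em_term_def pochhammer_rec fun_eq_iff add_ac algebra_simps)
  finally show ?thesis using assms by (subst (asm) sums_mult_iff) auto
qed

section \<open>Bounds and holomorphy of the Euler-Maclaurin error\<close>

lemma norm_pochhammer_le:
  "norm (s :: complex) \<le> R \<Longrightarrow> norm (pochhammer s n) \<le> pochhammer R n"
proof (induction n)
  case (Suc n)
  have "norm (s + of_nat n) \<le> norm s + norm (of_nat n :: complex)" by (rule norm_triangle_ineq)
  also have "\<dots> \<le> R + real n" using Suc.prems by simp
  finally have *: "norm (s + of_nat n) \<le> R + real n" .
  have "norm (pochhammer s n) * norm (s + of_nat n) \<le> pochhammer R n * (R + real n)"
    using Suc * by (intro mult_mono) (auto intro: order.trans[OF norm_ge_zero])
  thus ?case by (simp add: pochhammer_Suc norm_mult)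
qed simp

text \<open>For n = J + i + 1 and j \<le> J, every factorial (n - j)! is at least i!.\<close>

lemma em_beta_bound: "norm (em_beta J (Suc (J + i))) \<le> (\<Sum>j\<le>J. norm (bernoulli_num j) / fact j) / fact i"
proof -
  have "norm (em_beta J (Suc (J + i))) \<le> (\<Sum>j\<le>J. norm (bernoulli_num j) / fact j / fact (Suc (J + i) - j))"
    unfolding em_beta_def
    by (rule order.trans[OF norm_sum]) (auto intro!: sum_mono simp: norm_divide norm_mult)
  also have "\<dots> \<le> (\<Sum>j\<le>J. norm (bernoulli_num j) / fact j / fact i)"
    by (intro sum_mono divide_left_mono) (auto intro!: fact_mono)
  finally show ?thesis by (simp add: sum_divide_distrib)
qed

text \<open>The majorant is a multiple of the binomial series of (1 - 1/2)^(-(R + J)), since m \<ge>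
  2 gives m^(-i) \<le> 2^(-i). It depends on neither s nor m; the decay in m sits in the factor m^(R
  - J).\<close>

lemma em_term_bound:
  assumes "R > 0"
  obtains A :: "nat \<Rightarrow> real" where "A summable_on UNIV" "\<And>i. A i \<ge> 0"
    "\<And>s m i. cmod s < R \<Longrightarrow> m \<ge> 2 \<Longrightarrow> norm (em_term J s m i) \<le> real m powr (R - real J) * A i"
proof -
  define C where "C = (\<Sum>j\<le>J. norm (bernoulli_num j) / fact j)"
  define A where "A = (\<lambda>i. pochhammer R J * C * (pochhammer (R + real J) i / fact i * (1 / 2) ^ i))"
  have C: "C \<ge> 0" unfolding C_def by (intro sum_nonneg) auto
  have nn: "pochhammer R i \<ge> 0" "pochhammer (R + real J) i \<ge> 0" for i
    using assms by (auto intro!: pochhammer_nonneg)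
  show ?thesis
  proof (rule that[of A])
    show A0: "A i \<ge> 0" for i unfolding A_def using nn C by (intro mult_nonneg_nonneg divide_nonneg_nonneg) auto
    have "summable (\<lambda>i. ((- (R + real J)) gchoose i) * (- (1 / 2)) ^ i)"
      by (rule sums_summable[OF gen_binomial_real]) simp
    also have "(\<lambda>i. ((- (R + real J)) gchoose i) * (- (1 / 2)) ^ i) =
        (\<lambda>i. pochhammer (R + real J) i / fact i * (1 / 2) ^ i)"
    proof
      fix i :: nat
      have "(-1) ^ i * (- (1 / 2)) ^ i = ((1 / 2) ^ i :: real)" by (simp flip: power_mult_distrib)
      thus "((- (R + real J)) gchoose i) * (- (1 / 2)) ^ i = pochhammer (R + real J) i / fact i * (1 / 2) ^ i"
        by (simp add: gbinomial_pochhammer field_simps)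
    qed
    finally have "summable A" unfolding A_def by (rule summable_mult)
    thus "A summable_on UNIV" using A0 by (rule summable_nonneg_imp_summable_on)
    fix s m i assume s: "cmod s < R" and m: "(m::nat) \<ge> 2"
    have "real m powr (- Re s - real (J + i)) \<le> real m powr (R - real J + (- real i))"
      using m s abs_Re_le_cmod[of s] by (intro powr_mono) auto
    also have "\<dots> = real m powr (R - real J) * real m powr (- real i)" by (rule powr_add)
    also have "real m powr (- real i) \<le> (1 / 2) ^ i"
      using m by (simp add: powr_minus powr_realpow power_one_over divide_simps power_mono)
    finally have p: "real m powr (- Re s - real (J + i)) \<le> real m powr (R - real J) * (1 / 2) ^ i"
      using m by (simp add: mult_left_mono)
    have "norm (em_term J s m i) =
        norm (pochhammer s (J + i)) * norm (em_beta J (Suc (J + i))) * real m powr (- Re s - real (J + i))"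
      by (simp add: em_term_def norm_mult norm_nat_powr)
    also have "\<dots> \<le> pochhammer R (J + i) * (C / fact i) * (real m powr (R - real J) * (1 / 2) ^ i)"
      using norm_pochhammer_le[of s R "J + i"] em_beta_bound[of J i] s p nn C
      unfolding C_def by (intro mult_mono) auto
    also have "\<dots> = real m powr (R - real J) * A i"
      by (simp add: A_def pochhammer_product' field_simps)
    finally show "norm (em_term J s m i) \<le> real m powr (R - real J) * A i" .
  qed
qed

lemma em_err_eq:
  assumes "s \<noteq> 1" "m \<ge> 2" "J \<ge> 1"
  shows "em_err J s m = em_poly J s (m - 1) - em_poly J s m - of_nat m powr (- s)"
proof -
  obtain A :: "nat \<Rightarrow> real" where A: "A summable_on UNIV" "\<And>i. A i \<ge> 0"
    "\<And>s' m i. cmod s' < norm s + 1 \<Longrightarrow> m \<ge> 2 \<Longrightarrow>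
       norm (em_term J s' m i) \<le> real m powr (norm s + 1 - real J) * A i"
    using em_term_bound[of "norm s + 1" J] by (metis add_nonneg_pos norm_ge_zero zero_less_one)
  have "em_term J s m summable_on UNIV"
    by (rule abs_summable_summable, rule Infinite_Sum.abs_summable_on_comparison_test'
         [where g = "\<lambda>i. real m powr (norm s + 1 - real J) * A i"])
       (use A assms in \<open>auto intro: summable_on_cmult_right\<close>)
  hence "em_term J s m sums em_err J s m"
    unfolding em_err_def by (intro has_sum_imp_sums has_sum_infsum)
  with em_step_sums[OF assms] show ?thesis by (rule sums_unique2[symmetric])
qed

text \<open>Weierstrass M-test along the finite subsets of A, which covers unordered sums over
  tuples as well as series.\<close>

lemma holomorphic_infsum:
  assumes hol: "\<And>x. x \<in> A \<Longrightarrow> f x holomorphic_on ball z r"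
    and le: "\<And>x s. x \<in> A \<Longrightarrow> s \<in> ball z r \<Longrightarrow> norm (f x s) \<le> M x"
    and M: "M summable_on A"
  shows "(\<lambda>s. \<Sum>\<^sub>\<infinity>x\<in>A. f x s :: complex) holomorphic_on ball z r"
proof -
  have "(\<lambda>s. \<Sum>\<^sub>\<infinity>x\<in>A. f x s) field_differentiable at w" if w: "w \<in> ball z r" for w
  proof -
    obtain d where d: "d > 0" "cball w d \<subseteq> ball z r"
      using open_contains_cball_eq[OF open_ball] w by blast
    have "uniform_limit (cball w d) (\<lambda>X s. \<Sum>x\<in>X. f x s) (\<lambda>s. \<Sum>\<^sub>\<infinity>x\<in>A. f x s) (finite_subsets_at_top A)"
      using le d M by (intro Weierstrass_m_test_general) auto
    moreover have "\<forall>\<^sub>F X in finite_subsets_at_top A. continuous_on (cball w d) (\<lambda>s. \<Sum>x\<in>X. f x s) \<and>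
        (\<lambda>s. \<Sum>x\<in>X. f x s) holomorphic_on ball w d"
    proof (rule eventually_finite_subsets_at_top_weakI)
      fix X assume X: "finite X" "X \<subseteq> A"
      have "(\<lambda>s. \<Sum>x\<in>X. f x s) holomorphic_on ball z r"
        using X hol by (intro holomorphic_intros) auto
      thus "continuous_on (cball w d) (\<lambda>s. \<Sum>x\<in>X. f x s) \<and>
        (\<lambda>s. \<Sum>x\<in>X. f x s) holomorphic_on ball w d"
        using d(2) by (meson ball_subset_cball holomorphic_on_imp_continuous_on holomorphic_on_subset order.trans)
    qed
    ultimately have "(\<lambda>s. \<Sum>\<^sub>\<infinity>x\<in>A. f x s) holomorphic_on ball w d"
      using holomorphic_uniform_limit[of w d "\<lambda>X s. \<Sum>x\<in>X. f x s" "finite_subsets_at_top A"] by auto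
    thus ?thesis using d(1) by (simp add: holomorphic_on_imp_differentiable_at)
  qed
  thus ?thesis by (auto simp: holomorphic_on_open field_differentiable_def)
qed

lemma holomorphic_em_err:
  assumes "m \<ge> 2" "R > 0"
  shows "(\<lambda>s. em_err J s m) holomorphic_on ball 0 R"
proof -
  obtain A :: "nat \<Rightarrow> real" where A: "A summable_on UNIV" "\<And>i. A i \<ge> 0"
    "\<And>s m i. cmod s < R \<Longrightarrow> m \<ge> 2 \<Longrightarrow> norm (em_term J s m i) \<le> real m powr (R - real J) * A i"
    using em_term_bound[OF assms(2)] by metis
  show ?thesis unfolding em_err_def
  proof (rule holomorphic_infsum)
    show "(\<lambda>i. real m powr (R - real J) * A i) summable_on UNIV"
      using A by (intro summable_on_cmult_right)
    show "(\<lambda>s. em_term J s m i) holomorphic_on ball 0 R" for i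
      unfolding em_term_def pochhammer_prod using assms by (intro holomorphic_intros) auto
  qed (use A assms in auto)
qed

lemma em_err_bound:
  assumes "R > 0"
  obtains K where "K \<ge> 0"
    "\<And>s m. cmod s < R \<Longrightarrow> m \<ge> 2 \<Longrightarrow> norm (em_err J s m) \<le> K * real m powr (R - real J)"
proof -
  obtain A :: "nat \<Rightarrow> real" where A: "A summable_on UNIV" "\<And>i. A i \<ge> 0"
    "\<And>s m i. cmod s < R \<Longrightarrow> m \<ge> 2 \<Longrightarrow> norm (em_term J s m i) \<le> real m powr (R - real J) * A i"
    using em_term_bound[OF assms] by metis
  show ?thesis
  proof (rule that[of "infsum A UNIV"])
    show "infsum A UNIV \<ge> 0" using A by (intro infsum_nonneg) auto
    fix s m assume s: "cmod s < R" "(m::nat) \<ge> 2"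
    have A': "(\<lambda>i. real m powr (R - real J) * A i) summable_on UNIV"
      using A(1) by (rule summable_on_cmult_right)
    have "em_term J s m summable_on UNIV"
      by (rule abs_summable_summable, rule Infinite_Sum.abs_summable_on_comparison_test'[OF A'])
         (use A s in auto)
    hence "norm (em_err J s m) \<le> (\<Sum>\<^sub>\<infinity>i. real m powr (R - real J) * A i)"
      unfolding em_err_def
      by (intro norm_infsum_le[OF has_sum_infsum has_sum_infsum]) (use A A' s in auto)
    also have "\<dots> = real m powr (R - real J) * infsum A UNIV" by (rule infsum_cmult_right')
    finally show "norm (em_err J s m) \<le> infsum A UNIV * real m powr (R - real J)"
      by (simp only: mult.commute)
  qed
qed

lemma em_err_neg_nat:
  assumes "k < J"
  shows "em_err J (- of_nat k) m = 0"
proof -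
  have "em_term J (- of_nat k) m i = 0" for i
    using assms by (simp add: em_term_def pochhammer_of_nat_eq_0_lemma)
  thus ?thesis by (simp add: em_err_def)
qed

text \<open>The summand plus its error is a difference of consecutive values of
  \<open>em_poly\<close>, so the sum telescopes, and \<open>em_poly J b m\<close> tends to 0 because
  Re b > 1. The margin J \<ge> R + 2 makes the exponent R - J in the error bound at most -2.\<close>

lemma tail_has_sum:
  assumes b: "Re b > 1" and R: "R > cmod b" "real J \<ge> R + 2" and l: "l \<ge> 1"
  shows "((\<lambda>m. of_nat m powr (- b)) has_sum (em_poly J b l - (\<Sum>\<^sub>\<infinity>m\<in>{l<..}. em_err J b m))) {l<..}"
    and "(\<lambda>m. norm (em_err J b m)) summable_on {l<..}"
proof -
  have R0: "R > 0" using R(1) norm_ge_zero[of b] by linarith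
  have b1: "b \<noteq> 1" using b by auto
  obtain K where K: "K \<ge> 0"
    "\<And>s m. cmod s < R \<Longrightarrow> m \<ge> 2 \<Longrightarrow> norm (em_err J s m) \<le> K * real m powr (R - real J)"
    using em_err_bound[OF R0] by metis
  have ps: "(\<lambda>m. real m powr p) summable_on A" if "p < -1" for p A
    by (rule summable_on_subset_banach[OF summable_nonneg_imp_summable_on, of _ A])
       (use that in \<open>auto simp: summable_real_powr_iff\<close>)
  show E: "(\<lambda>m. norm (em_err J b m)) summable_on {l<..}"
    by (rule Infinite_Sum.abs_summable_on_comparison_test'[where g = "\<lambda>m. K * real m powr (R - real J)"])
       (use K R l in \<open>auto intro!: summable_on_cmult_right ps\<close>)
  hence E': "em_err J b summable_on {l<..}" by (rule abs_summable_summable)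
  have Z: "(\<lambda>m. norm (of_nat m powr (- b) :: complex)) summable_on {l<..}"
    unfolding norm_nat_powr using b by (intro ps) auto
  hence Z': "(\<lambda>m. of_nat m powr (- b) :: complex) summable_on {l<..}" by (rule abs_summable_summable)
  define S where "S = (\<Sum>\<^sub>\<infinity>m\<in>{l<..}. em_err J b m) + (\<Sum>\<^sub>\<infinity>m\<in>{l<..}. of_nat m powr (- b))"
  have "((\<lambda>m. em_err J b m + of_nat m powr (- b)) has_sum S) {l<..}"
    unfolding S_def using E' Z' by (intro has_sum_add has_sum_infsum)
  hence "((\<lambda>m. em_poly J b (m - 1) - em_poly J b m) has_sum S) {l<..}"
    by (rule has_sum_cong[THEN iffD1, rotated]) (use em_err_eq[OF b1, of _ J] R0 R l in auto)
  also have "?this \<longleftrightarrow> ((\<lambda>i. em_poly J b (l + i) - em_poly J b (l + Suc i)) has_sum S) UNIV"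
    by (rule has_sum_reindex_bij_witness[of _ "\<lambda>i. l + Suc i" "\<lambda>m. m - Suc l"]) auto
  finally have "(\<lambda>i. em_poly J b (l + i) - em_poly J b (l + Suc i)) sums S" by (rule has_sum_imp_sums)
  moreover have "(\<lambda>i. em_poly J b (l + i) - em_poly J b (l + Suc i)) sums (em_poly J b (l + 0) - 0)"
  proof (rule telescope_sums')
    have "(\<lambda>m. em_poly J b m) \<longlonglongrightarrow> (\<Sum>j\<le>J. bernoulli_num j / fact j * pochhammer (b - 1) j / (b - 1) * 0)"
      unfolding em_poly_def using b
      by (intro tendsto_sum tendsto_mult tendsto_const tendsto_neg_powr_complex_of_nat filterlim_ident) auto
    hence "(\<lambda>m. em_poly J b m) \<longlonglongrightarrow> 0" by simp
    thus "(\<lambda>i. em_poly J b (l + i)) \<longlonglongrightarrow> 0"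
      by (subst add.commute) (rule LIMSEQ_ignore_initial_segment)
  qed
  ultimately have "S = em_poly J b l" by (auto dest: sums_unique2)
  hence "em_poly J b l - (\<Sum>\<^sub>\<infinity>m\<in>{l<..}. em_err J b m) = (\<Sum>\<^sub>\<infinity>m\<in>{l<..}. of_nat m powr (- b))"
    by (simp add: S_def algebra_simps)
  thus "((\<lambda>m. of_nat m powr (- b)) has_sum (em_poly J b l - (\<Sum>\<^sub>\<infinity>m\<in>{l<..}. em_err J b m))) {l<..}"
    using has_sum_infsum[OF Z'] by simp
qed

text \<open>The 1 is the summand m = 1 in depth one. Removing the signs (-1)^j by
  \<open>bernoulli_num_neg\<close> costs a correction at j = 1, which cancels this 1; the remaining
  sum of C(k+1, j) B_j is B_(k+1)(1).\<close>

lemma em_poly_neg_nat: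
  assumes "J \<ge> Suc k"
  shows "1 + em_poly J (- of_nat k) 1 = - bernoulli_poly (k + 1) 1 / of_nat (k + 1)"
proof -
  let ?n = "Suc k"
  have p: "pochhammer (- of_nat ?n) j / fact j = ((-1) ^ j * of_nat (?n choose j) :: complex)" for j
  proof -
    have "of_nat (?n choose j) = (-1) ^ j * (pochhammer (- of_nat ?n) j / fact j :: complex)"
      by (simp only: binomial_gbinomial gbinomial_pochhammer) simp
    hence "(-1) ^ j * of_nat (?n choose j) = ((-1) * (-1)) ^ j * (pochhammer (- of_nat ?n) j / fact j :: complex)"
      by (simp only: power_mult_distrib mult.assoc)
    thus ?thesis by simp
  qed
  have "em_poly J (- of_nat k) 1 = (\<Sum>j\<le>J. bernoulli_num j * (pochhammer (- of_nat ?n) j / fact j) / (- of_nat ?n))"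
  proof -
    have "- of_nat k - 1 = (- of_nat ?n :: complex)" by simp
    moreover have "of_nat 1 powr x = (1 :: complex)" for x by simp
    ultimately show ?thesis by (simp only: em_poly_def) (simp del: of_nat_Suc)
  qed
  also have "\<dots> = - ((\<Sum>j\<le>J. of_nat (?n choose j) * ((-1) ^ j * bernoulli_num j)) / of_nat ?n)"
    unfolding p by (simp add: sum_divide_distrib sum_negf[symmetric] mult_ac del: of_nat_Suc)
  also have "(\<Sum>j\<le>J. of_nat (?n choose j) * ((-1) ^ j * bernoulli_num j)) =
      (\<Sum>j\<le>?n. of_nat (?n choose j) * ((-1) ^ j * bernoulli_num j))"
    using assms by (intro sum.mono_neutral_right) (auto simp: binomial_eq_0)
  also have "\<dots> = (\<Sum>j\<le>?n. of_nat (?n choose j) * bernoulli_num j + (if j = 1 then of_nat ?n else 0))"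
    by (subst bernoulli_num_neg) (intro sum.cong, auto simp: distrib_left)
  also have "\<dots> = bernoulli_poly ?n 1 + of_nat ?n"
    by (simp add: sum.distrib bernoulli_poly_def del: of_nat_Suc binomial_Suc_Suc sum.atMost_Suc)
  finally show ?thesis by (simp add: add_divide_distrib del: of_nat_Suc)
qed

subsection \<open>Splitting off the largest summation index\<close>

lemma incr_tuples_snoc_iff:
  assumes "r \<ge> 1"
  shows "n @ [m] \<in> incr_tuples (Suc r) \<longleftrightarrow> n \<in> incr_tuples r \<and> last n < m"
proof -
  have "x \<le> last n" if "sorted_wrt (<) n" "x \<in> set n" for x :: nat
    using that
  proof (induction n)
    case (Cons y ys)
    have "last ys \<in> set ys" if "ys \<noteq> []" using that by simp
    with Cons show ?case by (cases "ys = []") (auto intro: less_imp_le)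
  qed simp
  thus ?thesis using assms
    by (cases "n = []") (fastforce simp: incr_tuples_def sorted_wrt_append)+
qed

lemma incr_tuplesD:
  assumes "n \<in> incr_tuples (Suc r)"
  shows "length n = Suc r" "last n \<ge> 1" "\<And>i. i < Suc r \<Longrightarrow> n ! i \<ge> 1" "\<And>i. i < Suc r \<Longrightarrow> n ! i \<le> last n"
proof -
  show l: "length n = Suc r" using assms by (simp add: incr_tuples_def)
  hence ne: "n \<noteq> []" by auto
  show p: "n ! i \<ge> 1" if "i < Suc r" for i
  proof -
    have "n ! i \<in> set n" using l that by simp
    hence "n ! i > 0" using assms by (simp add: incr_tuples_def)
    thus ?thesis by simp
  qed
  show "last n \<ge> 1" using p[of r] l ne by (simp add: last_conv_nth)
  show "n ! i \<le> last n" if "i < Suc r" for i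
  proof (cases "i = r")
    case False
    hence "n ! i < n ! r"
      using assms l that sorted_wrt_nth_less[of "(<)" n i r] by (simp add: incr_tuples_def)
    thus ?thesis using l ne by (simp add: last_conv_nth)
  qed (use l ne in \<open>simp add: last_conv_nth\<close>)
qed

lemma has_sum_incr_tuples_Suc:
  assumes "r \<ge> 1"
  shows "(f has_sum S) (incr_tuples (Suc r)) \<longleftrightarrow>
     ((\<lambda>(n, m). f (n @ [m])) has_sum S) (SIGMA n:incr_tuples r. {last n<..})"
proof (rule has_sum_reindex_bij_witness[of _ "\<lambda>(n, m). n @ [m]" "\<lambda>n. (butlast n, last n)"])
  fix a assume a: "a \<in> incr_tuples (Suc r)"
  hence "a \<noteq> []" by (auto simp: incr_tuples_def)
  hence *: "butlast a @ [last a] = a" by simp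
  thus "(case (butlast a, last a) of (n, m) \<Rightarrow> n @ [m]) = a"
    "(case (butlast a, last a) of (n, m) \<Rightarrow> f (n @ [m])) = f a" by auto
  show "(butlast a, last a) \<in> (SIGMA n:incr_tuples r. {last n<..})"
    using a incr_tuples_snoc_iff[OF assms, of "butlast a" "last a"] * by auto
qed (use incr_tuples_snoc_iff[OF assms] in auto)

lemma mzv_term_append:
  assumes "length s = length n"
  shows "mzv_term (s @ [b]) (n @ [m]) = mzv_term s n * of_nat m powr (- b)"
  using assms by (simp add: mzv_term_def nth_append)

text \<open>In \<open>err_sum\<close> the exponents \<open>butlast s\<close> meet tuples with one
  entry more; the surplus entry is reserved for \<open>em_err\<close>.\<close>

lemma mzv_term_append_left:
  assumes "length s \<le> length n"
  shows "mzv_term s (n @ n') = mzv_term s n"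
  using assms by (simp add: mzv_term_def nth_append)

lemma mzv_term_shift_last:
  assumes "length n = Suc (length xs)"
  shows "mzv_term (xs @ [a + q]) n = mzv_term (xs @ [a]) n * of_nat (last n) powr (- q)"
proof -
  obtain n' l where n: "n = n' @ [l]" "length n' = length xs" using assms by (metis length_Suc_conv_rev)
  have "- (a + q) = - a + - q" by simp
  hence "(of_nat l :: complex) powr (- (a + q)) = of_nat l powr (- a) * of_nat l powr (- q)"
    by (simp only: powr_add)
  thus ?thesis using n by (simp add: mzv_term_append)
qed

lemma norm_mzv_term: "norm (mzv_term s n) = (\<Prod>i<length s. real (n ! i) powr (- Re (s ! i)))"
  by (simp add: mzv_term_def prod_norm[symmetric] norm_nat_powr)

text \<open>The common majorant of all remainder terms. It runs over all tuples, not just increasing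
  ones, so that the sum factorises; zero entries contribute 0 because
  \<open>0 powr (-2) = 0\<close>.\<close>

lemma summable_prod_square:
  "(\<lambda>n. \<Prod>i<r. real (n ! i) powr (-2)) summable_on {n. length n = r}"
proof (induction r)
  case (Suc r)
  let ?f = "\<lambda>n::nat list. \<Prod>i<r. real (n ! i) powr (-2)"
  have *: "(\<lambda>m. real m powr (-2)) summable_on UNIV"
    by (rule summable_nonneg_imp_summable_on) (auto simp: summable_real_powr_iff)
  have "(\<lambda>(n, m). ?f n * real m powr (-2)) summable_on (SIGMA n:{n. length n = r}. UNIV)"
  proof (rule summable_on_SigmaI)
    show "((\<lambda>m. case (n, m) of (n, m) \<Rightarrow> ?f n * real m powr (-2)) has_sum ?f n * (\<Sum>\<^sub>\<infinity>m::nat. real m powr (-2))) UNIV"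
      for n using * by (auto intro!: has_sum_cmult_right has_sum_infsum)
    show "(\<lambda>n. ?f n * (\<Sum>\<^sub>\<infinity>m::nat. real m powr (-2))) summable_on {n. length n = r}"
      using Suc by (rule summable_on_cmult_left)
  qed (auto intro!: mult_nonneg_nonneg prod_nonneg)
  also have "?this \<longleftrightarrow> ?case"
  proof (rule summable_on_reindex_bij_witness[of _ "\<lambda>n. (butlast n, last n)" "\<lambda>(n, m). n @ [m]"])
    fix n :: "nat list" assume "n \<in> {n. length n = Suc r}"
    hence "n \<noteq> []" by auto
    thus "(case (butlast n, last n) of (n, m) \<Rightarrow> n @ [m]) = n" by simp
  qed (auto simp: nth_append)
  finally show ?case .
qed simp

subsection \<open>The remainder of the summation over the largest index\<close>

text \<open>The bounds and the telescoping identity for \<open>em_err\<close> start at m = 2. The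
  restriction on the last entry matters in depth one only, where it leaves out the tuple
  \<open>[1]\<close>; in larger depth the largest index is at least 2 anyway.\<close>

definition err_sum :: "nat \<Rightarrow> complex list \<Rightarrow> complex" where
  "err_sum J s = (\<Sum>\<^sub>\<infinity>n\<in>{n\<in>incr_tuples (length s). last n \<ge> 2}.
      mzv_term (butlast s) n * em_err J (last s) (last n))"

text \<open>Every index is at most the last one, l, so each power n_i^(-s_i) is bounded by n_i^(-2)
  l^(N + 2). The r such factors and the error bound l^(N - J) combine to the exponent (N + 2) r + N
  - J, and the condition on J says exactly that this is at most -2.\<close>

lemma err_term_bound:
  assumes N: "N > 0" and J: "real J \<ge> (N + 2) * real (Suc r)"
  obtains K where "K \<ge> 0" "\<And>s n. s \<in> pdisc (replicate (Suc r) 0) N \<Longrightarrow> n \<in> incr_tuples (Suc r) \<Longrightarrow> last n \<ge> 2 \<Longrightarrow>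
     norm (mzv_term (butlast s) n * em_err J (last s) (last n)) \<le> K * (\<Prod>i<Suc r. real (n ! i) powr (-2))"
proof -
  obtain K where K: "K \<ge> 0"
    "\<And>s m. cmod s < N \<Longrightarrow> m \<ge> 2 \<Longrightarrow> norm (em_err J s m) \<le> K * real m powr (N - real J)"
    using em_err_bound[OF N] by metis
  show ?thesis
  proof (rule that[OF K(1)])
    fix s n assume s: "s \<in> pdisc (replicate (Suc r) 0) N" and n: "n \<in> incr_tuples (Suc r)" "last n \<ge> 2"
    note n' = incr_tuplesD[OF n(1)]
    let ?l = "real (last n)"
    have l: "?l \<ge> 1" using n'(2) by simp
    obtain xs b where xs: "s = xs @ [b]" "length xs = r"
      using s by (metis length_Suc_conv_rev length_in_pdisc length_replicate)
    have b: "cmod b < N" and xN: "\<And>i. i < r \<Longrightarrow> cmod (xs ! i) < N"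
      using s xs by (auto simp: pdisc_0_iff)
    have "norm (mzv_term xs n) \<le> (\<Prod>i<r. real (n ! i) powr (-2) * ?l powr (N + 2))"
      unfolding norm_mzv_term xs(2)
    proof (rule prod_mono, safe)
      fix i assume i: "i < r"
      have n1: "real (n ! i) \<ge> 1" "n ! i \<le> last n" using n'(3)[of i] n'(4)[of i] i by auto
      have "- Re (xs ! i) \<le> -2 + (N + 2)" using abs_Re_le_cmod[of "xs ! i"] xN[OF i] by linarith
      hence "real (n ! i) powr (- Re (xs ! i)) \<le> real (n ! i) powr (-2 + (N + 2))"
        using n1 by (intro powr_mono) auto
      also have "\<dots> = real (n ! i) powr (-2) * real (n ! i) powr (N + 2)" by (rule powr_add)
      also have "\<dots> \<le> real (n ! i) powr (-2) * ?l powr (N + 2)"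
        using n1 N by (intro mult_left_mono powr_mono2) auto
      finally show "real (n ! i) powr (- Re (xs ! i)) \<le> real (n ! i) powr (-2) * ?l powr (N + 2)" .
    qed auto
    also have "\<dots> = (\<Prod>i<r. real (n ! i) powr (-2)) * ?l powr ((N + 2) * real r)"
      using l by (simp add: prod.distrib powr_powr flip: powr_realpow)
    finally have 1: "norm (mzv_term xs n) \<le> \<dots>" .
    have "norm (mzv_term xs n * em_err J b (last n)) \<le>
       ((\<Prod>i<r. real (n ! i) powr (-2)) * ?l powr ((N + 2) * real r)) * (K * ?l powr (N - real J))"
      unfolding norm_mult using 1 K b n(2) by (intro mult_mono) (auto intro!: mult_nonneg_nonneg prod_nonneg)
    also have "\<dots> = K * (\<Prod>i<r. real (n ! i) powr (-2)) * ?l powr ((N + 2) * real r + (N - real J))"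
      by (simp add: powr_add)
    also have "\<dots> \<le> K * (\<Prod>i<r. real (n ! i) powr (-2)) * ?l powr (-2)"
      using l J K by (intro mult_left_mono powr_mono mult_nonneg_nonneg prod_nonneg) (auto simp: algebra_simps)
    also have "?l = real (n ! r)" using n'(1) by (subst last_conv_nth) auto
    finally show "norm (mzv_term (butlast s) n * em_err J (last s) (last n)) \<le> K * (\<Prod>i<Suc r. real (n ! i) powr (-2))"
      using xs by (simp add: mult_ac)
  qed
qed

lemma summable_err_dom:
  "(\<lambda>n. K * (\<Prod>i<r. real (n ! i) powr (-2))) summable_on {n\<in>incr_tuples r. last n \<ge> 2}"
  by (rule summable_on_cmult_right, rule summable_on_subset_banach[OF summable_prod_square])
     (auto simp: incr_tuples_def)

lemma err_sum_summable:
  assumes "N > 0" "real J \<ge> (N + 2) * real (Suc r)" "s \<in> pdisc (replicate (Suc r) 0) N"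
  shows "(\<lambda>n. mzv_term (butlast s) n * em_err J (last s) (last n)) summable_on
           {n\<in>incr_tuples (Suc r). last n \<ge> 2}"
proof -
  obtain K where K: "K \<ge> 0" "\<And>s n. s \<in> pdisc (replicate (Suc r) 0) N \<Longrightarrow> n \<in> incr_tuples (Suc r) \<Longrightarrow> last n \<ge> 2 \<Longrightarrow>
     norm (mzv_term (butlast s) n * em_err J (last s) (last n)) \<le> K * (\<Prod>i<Suc r. real (n ! i) powr (-2))"
    using err_term_bound[OF assms(1,2)] by metis
  show ?thesis
    by (rule abs_summable_summable, rule Infinite_Sum.abs_summable_on_comparison_test'[OF summable_err_dom[of K]])
       (use K assms in auto)
qed

text \<open>A single variable enters either one power or \<open>em_err\<close>, both holomorphic in
  it, and the majorant is uniform on the polydisc.\<close>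

lemma sep_hol_err_sum:
  assumes N: "N > 0" and J: "real J \<ge> (N + 2) * real (Suc r)"
  shows "sep_hol (err_sum J) (replicate (Suc r) 0) N"
  unfolding sep_hol_def
proof (intro ballI allI impI)
  fix w i assume w: "w \<in> pdisc (replicate (Suc r) 0) N" and i: "i < length (replicate (Suc r) (0::complex))"
  obtain K where K: "K \<ge> 0" "\<And>s n. s \<in> pdisc (replicate (Suc r) 0) N \<Longrightarrow> n \<in> incr_tuples (Suc r) \<Longrightarrow> last n \<ge> 2 \<Longrightarrow>
     norm (mzv_term (butlast s) n * em_err J (last s) (last n)) \<le> K * (\<Prod>i<Suc r. real (n ! i) powr (-2))"
    using err_term_bound[OF N J] by metis
  obtain xs b where xs: "w = xs @ [b]" "length xs = r"
    using w by (metis length_Suc_conv_rev length_in_pdisc length_replicate)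
  have wi: "w[i := t] \<in> pdisc (replicate (Suc r) 0) N" if "t \<in> ball 0 N" for t
    using w that by (auto simp: pdisc_0_iff dest!: set_update_subset_insert[THEN subsetD])
  have "(\<lambda>t. \<Sum>\<^sub>\<infinity>n\<in>{n\<in>incr_tuples (Suc r). last n \<ge> 2}.
      mzv_term (butlast (w[i := t])) n * em_err J (last (w[i := t])) (last n)) holomorphic_on ball 0 N"
  proof (rule holomorphic_infsum[OF _ _ summable_err_dom[of K]])
    fix n assume n: "n \<in> {n\<in>incr_tuples (Suc r). last n \<ge> 2}"
    show "norm (mzv_term (butlast (w[i := t])) n * em_err J (last (w[i := t])) (last n))
         \<le> K * (\<Prod>i<Suc r. real (n ! i) powr (-2))" if "t \<in> ball 0 N" for t
      using K(2)[OF wi[OF that]] n by auto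
    show "(\<lambda>t. mzv_term (butlast (w[i := t])) n * em_err J (last (w[i := t])) (last n)) holomorphic_on ball 0 N"
    proof (cases "i = r")
      case True
      have "(\<lambda>t. mzv_term xs n * em_err J t (last n)) holomorphic_on ball 0 N"
        using n N by (intro holomorphic_intros holomorphic_em_err) auto
      thus ?thesis using True xs by (simp add: list_update_append)
    next
      case False
      hence ir: "i < r" using i by simp
      have "(\<lambda>t. (of_nat (n ! j) :: complex) powr (- (xs[i := t] ! j))) holomorphic_on ball 0 N" if "j < r" for j
      proof (cases "j = i")
        case True
        moreover have "n ! i \<noteq> 0" using n incr_tuplesD(3)[of n r i] ir by auto
        ultimately show ?thesis using xs ir by (auto intro!: holomorphic_intros)
      qed simp
      hence "(\<lambda>t. mzv_term (xs[i := t]) n * em_err J b (last n)) holomorphic_on ball 0 N"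
        unfolding mzv_term_def length_list_update using xs
        by (intro holomorphic_on_mult holomorphic_on_prod holomorphic_on_const) auto
      thus ?thesis using ir xs by (simp add: list_update_append butlast_append)
    qed
  qed
  moreover have "length (w[i := t]) = Suc r" for t using xs by simp
  ultimately have "(\<lambda>t. err_sum J (w[i := t])) holomorphic_on ball 0 N" by (simp only: err_sum_def)
  moreover have "w ! i \<in> ball 0 N" using w i by (auto simp: pdisc_0_iff)
  ultimately show "(\<lambda>t. err_sum J (w[i := t])) field_differentiable at (w ! i)"
    by (meson holomorphic_on_imp_differentiable_at open_ball)
qed

lemma err_sum_neg_nat: "k < J \<Longrightarrow> err_sum J (xs @ [- of_nat k]) = 0"
  by (simp add: err_sum_def em_err_neg_nat)

subsection \<open>The recursion for the convergent series\<close>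

definition em_coef :: "nat \<Rightarrow> complex \<Rightarrow> complex" where
  "em_coef j s = bernoulli_num j / fact j * pochhammer (s - 1) j / (s - 1)"

lemma em_poly_coef: "em_poly J s m = (\<Sum>j\<le>J. em_coef j s * of_nat m powr (- (s + (of_nat j - 1))))"
  by (simp add: em_poly_def em_coef_def algebra_simps)

lemma summable_powr_tail:
  assumes "(\<lambda>m. norm (of_nat m powr (- b) :: complex)) summable_on {l<..}"
  shows "Re b > 1"
proof -
  have "(\<lambda>m. norm (of_nat m powr (- b) :: complex)) summable_on ({l<..} \<union> {..l})"
    using assms by (intro summable_on_union) auto
  also have "{l<..} \<union> {..l} = UNIV" by auto
  finally have "(\<lambda>m. real m powr (- Re b)) summable_on UNIV" by (simp add: norm_nat_powr)
  hence "summable (\<lambda>m. real m powr (- Re b))" by (simp add: summable_on_UNIV_nonneg_real_iff)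
  thus ?thesis by (simp add: summable_real_powr_iff)
qed

lemma has_sum_finite_sum:
  fixes f :: "'a \<Rightarrow> 'b \<Rightarrow> complex"
  assumes "finite F" "\<And>j. j \<in> F \<Longrightarrow> (f j has_sum S j) A"
  shows "((\<lambda>x. \<Sum>j\<in>F. f j x) has_sum (\<Sum>j\<in>F. S j)) A"
  using assms by (induction F rule: finite_induct) (auto intro: has_sum_add)

text \<open>Summability is the only information about convergence, since the location of the
  polydisc in \<open>mzv_continuation\<close> is unknown. Both Re b > 1 and the convergence of the
  merged series are extracted from it.\<close>

lemma mzv_recursion:
  assumes s: "xs @ [a, b] \<in> pdisc (replicate (Suc (Suc r)) 0) N" and N: "N > 0"
    and J: "real J \<ge> (N + 2) * real (Suc (Suc r))"
    and conv: "mzv_term (xs @ [a, b]) summable_on incr_tuples (Suc (Suc r))"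
  shows "Re b > 1"
    and "\<And>j. mzv_term (xs @ [a + b + (of_nat j - 1)]) summable_on incr_tuples (Suc r)"
    and "infsum (mzv_term (xs @ [a, b])) (incr_tuples (Suc (Suc r))) =
      (\<Sum>j\<le>J. em_coef j b * infsum (mzv_term (xs @ [a + b + (of_nat j - 1)])) (incr_tuples (Suc r)))
       - err_sum J (xs @ [a, b])"
proof -
  have len: "length xs = r" using length_in_pdisc[OF s] by simp
  have bN: "cmod b < N" using s by (auto simp: pdisc_0_iff)
  let ?I = "incr_tuples (Suc r)" and ?T = "mzv_term (xs @ [a])"
  let ?S = "infsum (mzv_term (xs @ [a, b])) (incr_tuples (Suc (Suc r)))"
  have snoc: "mzv_term (xs @ [a, b]) (n @ [m]) = ?T n * of_nat m powr (- b)" if "n \<in> ?I" for n m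
    using mzv_term_append[of "xs @ [a]" n b m] incr_tuplesD(1)[OF that] len by simp
  have "((\<lambda>(n, m). mzv_term (xs @ [a, b]) (n @ [m])) has_sum ?S) (SIGMA n:?I. {last n<..})"
    using has_sum_infsum[OF conv] by (subst (asm) has_sum_incr_tuples_Suc) auto
  also have "?this \<longleftrightarrow> ((\<lambda>(n, m). ?T n * of_nat m powr (- b)) has_sum ?S) (SIGMA n:?I. {last n<..})"
    by (rule has_sum_cong) (auto simp: snoc)
  finally have S: "((\<lambda>(n, m). ?T n * of_nat m powr (- b)) has_sum ?S) (SIGMA n:?I. {last n<..})" .
  hence "(\<lambda>p. norm ((\<lambda>(n, m). ?T n * of_nat m powr (- b)) p)) summable_on (SIGMA n:?I. {last n<..})"
    using summable_on_iff_abs_summable_on_complex has_sum_imp_summable by blast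
  hence abs: "(\<lambda>(n, m). norm (?T n) * real m powr (- Re b)) summable_on (SIGMA n:?I. {last n<..})"
    by (simp add: case_prod_unfold norm_mult norm_nat_powr)
  show b: "Re b > 1"
  proof -
    \<comment> \<open>One fixed tuple of outer indices is enough: for it the inner sum over m must
      converge absolutely.\<close>
    let ?n = "[1..<Suc (Suc r)]"
    have "?n \<in> ?I" by (auto simp: incr_tuples_def simp del: upt_Suc)
    from summable_on_SigmaD1[OF abs this]
    have "(\<lambda>m. norm (?T ?n) * norm (of_nat m powr (- b) :: complex)) summable_on {last ?n<..}"
      by (simp only: norm_nat_powr) simp
    moreover have "norm (?T ?n) \<noteq> 0" using len by (auto simp: mzv_term_def simp del: upt_Suc of_nat_Suc)
    ultimately show ?thesis by (intro summable_powr_tail) (simp add: summable_on_cmult_right')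
  qed
  define h where "h = (\<lambda>n. \<Sum>\<^sub>\<infinity>m\<in>{last n<..}. norm (?T n) * real m powr (- Re b))"
  have h: "h summable_on ?I" unfolding h_def using summable_on_Sigma_banach[OF abs] .
  show conv': "mzv_term (xs @ [a + b + (of_nat j - 1)]) summable_on ?I" for j
  proof (rule abs_summable_summable, rule Infinite_Sum.abs_summable_on_comparison_test')
    show "(\<lambda>n. 2 powr Re b * h n) summable_on ?I" using h by (rule summable_on_cmult_right)
    fix n assume n: "n \<in> ?I"
    note n' = incr_tuplesD[OF n]
    define l where "l = last n"
    have l: "l \<ge> 1" using n' by (simp add: l_def)
    have "norm (mzv_term (xs @ [a + (b + (of_nat j - 1))]) n) = norm (?T n) * real l powr (- (Re b + real j - 1))"
    proof -
      have "- Re (b + (of_nat j - 1)) = - (Re b + real j - 1)" by simp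
      moreover have "length n = Suc (length xs)" using n' len by simp
      ultimately show ?thesis
        by (simp only: mzv_term_shift_last norm_mult norm_nat_powr l_def uminus_complex.sel)
    qed
    also have "\<dots> \<le> norm (?T n) * real l powr (1 + - Re b)"
      using l by (intro mult_left_mono powr_mono) auto
    also have "\<dots> = norm (?T n) * (real l * real l powr (- Re b))" using l by (simp only: powr_add) simp
    \<comment> \<open>The block l < m \<le> 2 l has l terms, each at least (2 l)^(-Re b). Part of
      the inner sum therefore already dominates the merged term for j = 0, and larger j only lower
      the exponent.\<close>
    also have "\<dots> = 2 powr Re b * (\<Sum>m\<in>{l<..2*l}. norm (?T n) * real (2 * l) powr (- Re b))"
      using l by (simp add: powr_mult powr_minus field_simps)
    also have "\<dots> \<le> 2 powr Re b * (\<Sum>m\<in>{l<..2*l}. norm (?T n) * real m powr (- Re b))"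
      using b l by (intro mult_left_mono sum_mono powr_mono2') auto
    also have "\<dots> \<le> 2 powr Re b * h n"
      unfolding h_def l_def[symmetric] using summable_on_SigmaD1[OF abs n]
      by (intro mult_left_mono finite_sum_le_infsum) (auto simp: l_def)
    finally show "norm (mzv_term (xs @ [a + b + (of_nat j - 1)]) n) \<le> 2 powr Re b * h n"
      by (simp add: add.assoc)
  qed
  have JN: "real J \<ge> N + 2"
  proof -
    have "(N + 2) * 1 \<le> (N + 2) * real (Suc (Suc r))" using N by (intro mult_left_mono) auto
    from order.trans[OF this J] show ?thesis by simp
  qed
  define R where "R = (\<lambda>l. \<Sum>\<^sub>\<infinity>m\<in>{l<..}. em_err J b m)"
  have "((\<lambda>n. ?T n * (em_poly J b (last n) - R (last n))) has_sum ?S) ?I"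
  proof (rule has_sum_SigmaD[OF S])
    fix n assume "n \<in> ?I"
    hence "last n \<ge> 1" by (rule incr_tuplesD)
    from tail_has_sum(1)[OF b bN JN this]
    show "((\<lambda>m. case (n, m) of (n, m) \<Rightarrow> ?T n * of_nat m powr (- b)) has_sum
        ?T n * (em_poly J b (last n) - R (last n))) {last n<..}"
      by (auto intro!: has_sum_cmult_right simp: R_def)
  qed
  moreover have "((\<lambda>n. ?T n * R (last n)) has_sum err_sum J (xs @ [a, b])) ?I"
  proof -
    let ?g = "\<lambda>n. mzv_term (xs @ [a]) n * em_err J b (last n)"
    \<comment> \<open>From depth two on, the largest index exceeds another positive one, so
      \<open>err_sum\<close> runs over all tuples.\<close>
    have "{n \<in> incr_tuples (Suc (Suc r)). last n \<ge> 2} = incr_tuples (Suc (Suc r))"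
    proof -
      have "last n \<ge> 2" if "n \<in> incr_tuples (Suc (Suc r))" for n
      proof -
        have ne: "n \<noteq> []" using that by (auto simp: incr_tuples_def)
        have "butlast n \<in> ?I \<and> last (butlast n) < last n"
          using that incr_tuples_snoc_iff[of "Suc r" "butlast n" "last n"] ne by simp
        thus ?thesis using incr_tuplesD(2)[of "butlast n" r] by linarith
      qed
      thus ?thesis by blast
    qed
    moreover have "butlast (xs @ [a, b]) = xs @ [a]" "last (xs @ [a, b]) = b"
      "length (xs @ [a, b]) = Suc (Suc r)" using len by (simp_all add: butlast_append)
    ultimately have "(?g has_sum err_sum J (xs @ [a, b])) (incr_tuples (Suc (Suc r)))"
      using has_sum_infsum[OF err_sum_summable[OF N J s]] by (simp only: err_sum_def)
    hence G: "((\<lambda>(n, m). ?g (n @ [m])) has_sum err_sum J (xs @ [a, b])) (SIGMA n:?I. {last n<..})"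
      by (rule has_sum_incr_tuples_Suc[of "Suc r" ?g, THEN iffD1, rotated]) simp
    have "((\<lambda>m. ?T (n @ [m]) * em_err J b (last (n @ [m]))) has_sum ?T n * R (last n)) {last n<..}"
      if n: "n \<in> ?I" for n
    proof -
      note n' = incr_tuplesD[OF n]
      have "(em_err J b has_sum R (last n)) {last n<..}"
        unfolding R_def by (rule has_sum_infsum[OF abs_summable_summable[OF tail_has_sum(2)[OF b bN JN n'(2)]]])
      hence "((\<lambda>m. ?T n * em_err J b m) has_sum ?T n * R (last n)) {last n<..}"
        by (rule has_sum_cmult_right)
      thus ?thesis using n' len by (simp add: mzv_term_append_left)
    qed
    thus ?thesis by (intro has_sum_SigmaD[OF G]) simp
  qed
  \<comment> \<open>Adding the remainder back cancels it inside the sum and leaves the pure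
    \<open>em_poly\<close> part, a finite combination of merged series.\<close>
  ultimately have "((\<lambda>n. ?T n * (em_poly J b (last n) - R (last n)) + ?T n * R (last n)) has_sum
      (?S + err_sum J (xs @ [a, b]))) ?I" by (rule has_sum_add)
  hence "((\<lambda>n. ?T n * em_poly J b (last n)) has_sum (?S + err_sum J (xs @ [a, b]))) ?I"
    by (simp add: algebra_simps)
  also have "?this \<longleftrightarrow> ((\<lambda>n. \<Sum>j\<le>J. em_coef j b * mzv_term (xs @ [a + (b + (of_nat j - 1))]) n) has_sum
       (?S + err_sum J (xs @ [a, b]))) ?I"
  proof (rule has_sum_cong)
    fix n assume "n \<in> ?I"
    hence "length n = Suc (length xs)" using len by (simp add: incr_tuples_def)
    thus "?T n * em_poly J b (last n) = (\<Sum>j\<le>J. em_coef j b * mzv_term (xs @ [a + (b + (of_nat j - 1))]) n)"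
      unfolding em_poly_coef sum_distrib_left by (simp only: mzv_term_shift_last mult_ac)
  qed
  finally have "((\<lambda>n. \<Sum>j\<le>J. em_coef j b * mzv_term (xs @ [a + b + (of_nat j - 1)]) n) has_sum
       (?S + err_sum J (xs @ [a, b]))) ?I" by (simp only: add.assoc)
  moreover have "((\<lambda>n. \<Sum>j\<le>J. em_coef j b * mzv_term (xs @ [a + b + (of_nat j - 1)]) n) has_sum
       (\<Sum>j\<le>J. em_coef j b * infsum (mzv_term (xs @ [a + b + (of_nat j - 1)])) ?I)) ?I"
    using conv' by (intro has_sum_finite_sum has_sum_cmult_right has_sum_infsum) auto
  ultimately have "?S + err_sum J (xs @ [a, b]) =
      (\<Sum>j\<le>J. em_coef j b * infsum (mzv_term (xs @ [a + b + (of_nat j - 1)])) ?I)"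
    by (rule has_sum_unique)
  thus "?S = (\<Sum>j\<le>J. em_coef j b * infsum (mzv_term (xs @ [a + b + (of_nat j - 1)])) ?I)
       - err_sum J (xs @ [a, b])"
    by (simp only: eq_diff_eq)
qed

subsection \<open>The continuation on large polydiscs\<close>

text \<open>The limit formula belongs to the induction claim because the step in depth r needs it at
  all shifted arguments in depth r - 1; k < N places the limit point inside the polydisc.\<close>

definition mzv_cont_on :: "nat \<Rightarrow> real \<Rightarrow> (complex list \<Rightarrow> complex) \<Rightarrow> bool" where
  "mzv_cont_on r N W \<longleftrightarrow> mer W (replicate r 0) N \<and>
     (\<forall>s\<in>pdisc (replicate r 0) N. mzv_term s summable_on incr_tuples r \<longrightarrow>
        W s = infsum (mzv_term s) (incr_tuples r)) \<and>
     (\<forall>ks. length ks = r \<longrightarrow> (\<forall>k\<in>set ks. real k < N) \<longrightarrow>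
        iter_lim W (map (\<lambda>k. - of_nat k) ks) (mult_zeta_neg ks 1))"

lemma mer_em_coef:
  assumes "i < n" "N > 0"
  shows "mer (\<lambda>s. em_coef j (s ! i)) (replicate n 0) N"
  unfolding em_coef_def
proof (rule mer_divide)
  show "sep_hol (\<lambda>s. bernoulli_num j / fact j * pochhammer (s ! i - 1) j) (replicate n 0) N"
    by (rule sep_hol_nth[of "\<lambda>x. bernoulli_num j / fact j * pochhammer (x - 1) j"])
       (auto simp: pochhammer_prod intro!: holomorphic_intros)
  show "sep_hol (\<lambda>s. s ! i - 1) (replicate n 0) N"
    by (rule sep_hol_nth[of "\<lambda>x. x - 1"]) (auto intro!: holomorphic_intros)
  show "\<exists>w\<in>pdisc (replicate n 0) N. w ! i - 1 \<noteq> 0"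
    using assms center_in_pdisc[of N "replicate n 0"] by (intro bexI[of _ "replicate n 0"]) auto
qed

lemma isCont_em_coef: "s \<noteq> 1 \<Longrightarrow> isCont (em_coef j) s"
  unfolding em_coef_def pochhammer_prod by (intro continuous_intros) auto

lemma neg_of_nat_ne_1: "- of_nat k \<noteq> (1 :: complex)"
proof
  assume "- of_nat k = (1 :: complex)"
  hence "Re (- of_nat k) = Re 1" by (simp only:)
  thus False by simp
qed

lemma isCont_err_sum_last:
  assumes "N > 0" "real J \<ge> (N + 2) * real (Suc r)" "s @ [b] \<in> pdisc (replicate (Suc r) 0) N"
  shows "isCont (\<lambda>t. err_sum J (s @ [t])) b"
proof -
  have l: "length s = r" using length_in_pdisc[OF assms(3)] by simp
  show ?thesis
    using sep_holD[OF sep_hol_err_sum[OF assms(1,2)] assms(3), of r] l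
    by (intro field_differentiable_imp_continuous_at) (simp add: list_update_append nth_append)
qed

lemma mzv_cont_on_1:
  assumes N: "N > 0"
  shows "\<exists>W. mzv_cont_on (Suc 0) N W"
proof -
  define J where "J = nat \<lceil>N + 2\<rceil>"
  have J: "real J \<ge> (N + 2) * real (Suc 0)" and J': "real J \<ge> N + 2"
    using N by (auto simp: J_def)
  \<comment> \<open>The summand n_1 = 1 is split off and Euler-Maclaurin starts at l = 1, where all
    powers of l equal 1.\<close>
  define W where "W = (\<lambda>s. 1 + (\<Sum>j\<le>J. em_coef j (s ! 0)) - err_sum J s)"
  have "mer W (replicate (Suc 0) 0) N"
    unfolding W_def using N J
    by (intro mer_diff mer_add mer_sum mer_em_coef mer_sep_hol sep_hol_const sep_hol_err_sum) auto
  moreover have "W s = infsum (mzv_term s) (incr_tuples (Suc 0))"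
    if s: "s \<in> pdisc (replicate (Suc 0) 0) N" and conv: "mzv_term s summable_on incr_tuples (Suc 0)" for s
  proof -
    obtain b where b: "s = [b]" using length_in_pdisc[OF s] by (auto simp: length_Suc_conv)
    have bN: "cmod b < N" using s b by (auto simp: pdisc_0_iff)
    have reidx: "(f has_sum S) {n \<in> incr_tuples (Suc 0). last n > l} \<longleftrightarrow> ((\<lambda>m. f [m]) has_sum S) {l<..}"
      for f :: "nat list \<Rightarrow> complex" and S l
      by (rule has_sum_reindex_bij_witness[of _ "\<lambda>m. [m]" hd])
         (auto simp: incr_tuples_def length_Suc_conv)
    have I0: "{n \<in> incr_tuples (Suc 0). last n > 0} = incr_tuples (Suc 0)"
      by (auto simp: incr_tuples_def length_Suc_conv)
    have I1: "{n \<in> incr_tuples (Suc 0). last n > 1} = {n \<in> incr_tuples (Suc 0). last n \<ge> 2}" by auto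
    have mt: "mzv_term s [m] = of_nat m powr (- b)" for m by (simp add: mzv_term_def b)
    let ?S = "infsum (mzv_term s) (incr_tuples (Suc 0))"
    have S: "((\<lambda>m. of_nat m powr (- b)) has_sum ?S) {0<..}"
      using has_sum_infsum[OF conv] reidx[of "mzv_term s" 0 ?S] by (simp only: I0 mt)
    have "(\<lambda>m. norm (of_nat m powr (- b) :: complex)) summable_on {0<..}"
      using has_sum_imp_summable[OF S] by (rule summable_on_iff_abs_summable_on_complex[THEN iffD1])
    hence Re: "Re b > 1" by (rule summable_powr_tail)
    have E: "((\<lambda>m. em_err J b m) has_sum err_sum J s) {1<..}"
    proof -
      have "((\<lambda>n. mzv_term (butlast s) n * em_err J (last s) (last n)) has_sum err_sum J s)
             {n \<in> incr_tuples (Suc 0). last n \<ge> 2}"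
        using has_sum_infsum[OF err_sum_summable[OF N J s]] length_in_pdisc[OF s]
        by (simp only: err_sum_def length_replicate)
      thus ?thesis unfolding I1[symmetric] reidx by (simp add: b mzv_term_def)
    qed
    have "((\<lambda>m. of_nat m powr (- b)) has_sum (em_poly J b 1 - err_sum J s)) {1<..}"
      using tail_has_sum(1)[OF Re bN J', of 1] infsumI[OF E] by simp
    hence "((\<lambda>m. of_nat m powr (- b)) has_sum (of_nat 1 powr (- b) + (em_poly J b 1 - err_sum J s))) (insert 1 {1<..})"
      by (intro has_sum_insert) auto
    also have "insert 1 {1<..} = {0::nat<..}" by auto
    finally have "?S = of_nat 1 powr (- b) + (em_poly J b 1 - err_sum J s)"
      using S by (metis has_sum_unique)
    thus ?thesis by (simp add: W_def em_poly_coef b)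
  qed
  moreover have "iter_lim W (map (\<lambda>k. - of_nat k) ks) (mult_zeta_neg ks 1)"
    if ks: "length ks = Suc 0" "\<forall>k\<in>set ks. real k < N" for ks
  proof -
    obtain k where k: "ks = [k]" using ks by (auto simp: length_Suc_conv)
    have kJ: "k < J" using ks k J' by simp
    have kp: "[] @ [- of_nat k] \<in> pdisc (replicate (Suc 0) 0) N" using ks k by (simp add: pdisc_0_iff)
    have "isCont (\<lambda>t. W [t]) (- of_nat k)"
      unfolding W_def using isCont_err_sum_last[OF N J kp] neg_of_nat_ne_1[of k]
      by (intro continuous_intros) (auto intro: isCont_em_coef)
    hence "((\<lambda>t. W [t]) \<longlongrightarrow> W [- of_nat k]) (at (- of_nat k))" by (simp add: isCont_def)
    moreover have "W [- of_nat k] = mult_zeta_neg ks 1"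
    proof -
      have "W [- of_nat k] = 1 + em_poly J (- of_nat k) 1"
        using err_sum_neg_nat[OF kJ, of "[]"] by (simp add: W_def em_poly_coef)
      also have "\<dots> = mult_zeta_neg ks 1"
        using em_poly_neg_nat[of k J] kJ by (simp add: mult_zeta_neg_def k)
      finally show ?thesis .
    qed
    ultimately show ?thesis by (auto simp: k intro!: exI[of _ "\<lambda>t. W [t]"])
  qed
  ultimately show ?thesis unfolding mzv_cont_on_def by blast
qed

text \<open>The three parts of the recursion form one Euler-Maclaurin sum: j = 0 gives -1 / (b + 1),
  j = 1 gives B_1 = -1/2, and j = q + 1 gives the rest. As j \<le> b + 1, the subtraction of
  naturals does not truncate.\<close>

lemma mzn_rev_em_coef:
  "mzn_rev (b # a # rest) z = (\<Sum>j\<le>Suc b. em_coef j (- of_nat b) * mzn_rev ((a + b + 1 - j) # rest) z)"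
proof -
  let ?f = "\<lambda>j. em_coef j (- of_nat b) * mzn_rev ((a + b + 1 - j) # rest) z"
  have ne: "- of_nat b - 1 \<noteq> (0::complex)" using neg_of_nat_ne_1[of b] by simp
  have c: "em_coef (Suc q) (- of_nat b) = bernoulli_num (Suc q) / fact (Suc q) * pochhammer (- of_nat b) q" for q
    using ne by (simp add: em_coef_def pochhammer_rec)
  have c0: "em_coef 0 (- of_nat b) = - (1 / of_nat (b + 1))"
  proof -
    have "- of_nat b - 1 = - (of_nat (b + 1) :: complex)" by simp
    hence "em_coef 0 (- of_nat b) = 1 / - (of_nat (b + 1) :: complex)" by (simp only: em_coef_def) simp
    thus ?thesis by (simp only: divide_minus_right)
  qed
  have "(\<Sum>j\<le>Suc b. ?f j) = ?f 0 + (\<Sum>q\<le>b. ?f (Suc q))" by (rule sum.atMost_Suc_shift)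
  also have "(\<Sum>q\<le>b. ?f (Suc q)) = ?f (Suc 0) + (\<Sum>q\<in>{1..b}. ?f (Suc q))"
    by (simp add: atLeast0AtMost[symmetric] sum.atLeast_Suc_atMost)
  also have "?f 0 = - (1 / of_nat (b + 1)) * mzn_rev ((a + b + 1) # rest) z"
    unfolding c0 by simp
  also have "?f (Suc 0) = - (1 / 2) * mzn_rev ((a + b) # rest) z" by (simp add: c)
  also have "(\<Sum>q\<in>{1..b}. ?f (Suc q)) = (\<Sum>q\<in>{1..b}. pochhammer (- of_nat b) q * bernoulli_num (q + 1) / fact (q + 1)
                        * mzn_rev ((a + b - q) # rest) z)"
    by (intro sum.cong refl) (simp add: c)
  finally show ?thesis by simp
qed

lemma mzv_cont_on_Suc:
  assumes N: "N > 0" and IH: "\<And>N. N > 0 \<Longrightarrow> \<exists>W. mzv_cont_on (Suc r) N W"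
  shows "\<exists>W. mzv_cont_on (Suc (Suc r)) N W"
proof -
  define J where "J = nat \<lceil>(N + 2) * real (Suc (Suc r))\<rceil>"
  have J: "real J \<ge> (N + 2) * real (Suc (Suc r))" unfolding J_def by (rule real_nat_ceiling_ge)
  have JN: "real J \<ge> N + 2"
  proof -
    have "(N + 2) * 1 \<le> (N + 2) * real (Suc (Suc r))" using N by (intro mult_left_mono) auto
    from order.trans[OF this J] show ?thesis by simp
  qed
  \<comment> \<open>Merging produces the last coordinate a + b + j - 1 with j \<le> J, whose modulus
    is below 2 N + J + 1.\<close>
  define N' where "N' = 2 * N + real J + 1"
  have N': "N' > 0" "2 * N + 1 \<le> N'" using N by (auto simp: N'_def)
  obtain V where V: "mzv_cont_on (Suc r) N' V" using IH[OF N'(1)] by blast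
  have Vm: "mer V (replicate (Suc r) 0) N'" using V by (simp add: mzv_cont_on_def)
  have VS: "V s = infsum (mzv_term s) (incr_tuples (Suc r))"
    if "s\<in>pdisc (replicate (Suc r) 0) N'" "mzv_term s summable_on incr_tuples (Suc r)" for s
    using V that unfolding mzv_cont_on_def by blast
  have VL: "iter_lim V (map (\<lambda>k. - of_nat k) ks) (mult_zeta_neg ks 1)"
    if "length ks = Suc r" "\<forall>k\<in>set ks. real k < N'" for ks
    using V that unfolding mzv_cont_on_def by blast
  have q: "2 * N + cmod (of_nat j - 1) \<le> N'" if "j \<le> J" for j
  proof -
    have "cmod (of_nat j - 1) \<le> real j + 1" using norm_triangle_ineq4[of "of_nat j" "1::complex"] by simp
    thus ?thesis using that by (simp add: N'_def)
  qed
  define W where "W = (\<lambda>s. (\<Sum>j\<le>J. em_coef j (s ! Suc r) * V (merge (of_nat j - 1) s)) - err_sum J s)"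
  have "mer W (replicate (Suc (Suc r)) 0) N"
    unfolding W_def using N J q
    by (intro mer_diff mer_sum mer_mult mer_em_coef mer_merge[OF Vm] mer_sep_hol sep_hol_err_sum) auto
  moreover have "W s = infsum (mzv_term s) (incr_tuples (Suc (Suc r)))"
    if s: "s \<in> pdisc (replicate (Suc (Suc r)) 0) N"
      and conv: "mzv_term s summable_on incr_tuples (Suc (Suc r))" for s
  proof -
    have "length s = Suc (Suc r)" using length_in_pdisc[OF s] by simp
    then obtain xs a b where xs: "s = xs @ [a, b]" "length xs = r" by (elim length_Suc_Suc_decomp)
    note rec = mzv_recursion[OF s[unfolded xs(1)] N J conv[unfolded xs(1)]]
    have "V (xs @ [a + b + (of_nat j - 1)]) = infsum (mzv_term (xs @ [a + b + (of_nat j - 1)])) (incr_tuples (Suc r))"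
      if "j \<le> J" for j
      using merge_in_pdisc[OF s q[OF that]] rec(2) by (intro VS) (simp_all add: xs)
    thus ?thesis unfolding xs(1) rec(3) W_def using xs(2) by (simp add: nth_append)
  qed
  moreover have "iter_lim W (map (\<lambda>k. - of_nat k) ks) (mult_zeta_neg ks 1)"
    if ks: "length ks = Suc (Suc r)" "\<forall>k\<in>set ks. real k < N" for ks
  proof -
    obtain xs a b where xs: "ks = xs @ [a, b]" "length xs = r"
      using ks(1) by (metis append.assoc append_Cons append_Nil length_Suc_conv_rev)
    have bN: "real b < N" and aN: "real a < N" and xN: "\<And>x. x \<in> set xs \<Longrightarrow> real x < N" using ks xs by auto
    have bJ: "b < J" using bN JN by linarith
    define ys where "ys = map (\<lambda>k. - of_nat k :: complex) xs"
    define \<beta> where "\<beta> = (- of_nat b :: complex)"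
    \<comment> \<open>The innermost limit as a function of the other variables; the remainder is
      absent because it vanishes at \<beta> for b < J.\<close>
    define g where "g = (\<lambda>s. \<Sum>j\<le>J. em_coef j \<beta> * V (shift_last (\<beta> + (of_nat j - 1)) s))"
    have \<beta>: "\<beta> \<noteq> 1" unfolding \<beta>_def by (rule neg_of_nat_ne_1)
    have as: "ys @ [- of_nat a] \<in> pdisc (replicate (Suc r) 0) N"
      using xN aN xs by (auto simp: pdisc_0_iff ys_def)
    obtain d where d: "d > 0" "pdisc (ys @ [- of_nat a]) d \<subseteq> pdisc (replicate (Suc r) 0) N"
      using pdisc_open[OF as] by blast
    \<comment> \<open>Each shift moves the limit point to another point of the larger polydisc,
      where V is generically continuous in its last variable; finitely many j can be treated
      together.\<close>
    have "iter_ev (\<lambda>s. isCont (\<lambda>x. V (butlast (shift_last (\<beta> + (of_nat j - 1)) s) @ [x]))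
            (last (shift_last (\<beta> + (of_nat j - 1)) s))) (ys @ [- of_nat a])" if "j \<in> {..J}" for j
    proof (rule iter_ev_shift_last, rule mer_isCont_last[OF Vm])
      have "cmod (- of_nat a + (\<beta> + (of_nat j - 1))) \<le> real a + (real b + cmod (of_nat j - 1))"
        unfolding \<beta>_def by (intro norm_triangle_le add_mono) auto
      also have "\<dots> < N'" using q[of j] that aN bN by simp
      finally show "ys @ [- of_nat a + (\<beta> + (of_nat j - 1))] \<in> pdisc (replicate (Suc r) 0) N'"
        using xN N' N xs by (fastforce simp: pdisc_0_iff ys_def)
    qed
    hence "iter_ev (\<lambda>s. \<forall>j\<in>{..J}. isCont (\<lambda>x. V (butlast (shift_last (\<beta> + (of_nat j - 1)) s) @ [x]))
            (last (shift_last (\<beta> + (of_nat j - 1)) s))) (ys @ [- of_nat a])"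
      by (intro iter_ev_ball) auto
    from iter_ev_conj[OF this iter_ev_pdisc[OF d(1)]]
    have "iter_ev (\<lambda>s. ((\<lambda>t. W (s @ [t])) \<longlongrightarrow> g s) (at \<beta>)) (ys @ [- of_nat a])"
    proof (rule iter_ev_mono, elim conjE)
      fix s assume cont: "\<forall>j\<in>{..J}. isCont (\<lambda>x. V (butlast (shift_last (\<beta> + (of_nat j - 1)) s) @ [x]))
            (last (shift_last (\<beta> + (of_nat j - 1)) s))"
        and s: "s \<in> pdisc (ys @ [- of_nat a]) d"
      have len: "length s = Suc r" using length_in_pdisc[OF s] xs by (simp add: ys_def)
      have "s @ [\<beta>] \<in> pdisc (replicate (Suc (Suc r)) 0) N"
        using s d bN by (auto simp: pdisc_0_iff \<beta>_def dest!: subsetD)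
      from isCont_err_sum_last[OF N J this]
      have E: "((\<lambda>t. err_sum J (s @ [t])) \<longlongrightarrow> 0) (at \<beta>)"
        using err_sum_neg_nat[OF bJ, of s] by (simp add: isCont_def \<beta>_def)
      have Vlim: "((\<lambda>t. V (shift_last (t + (of_nat j - 1)) s)) \<longlongrightarrow> V (shift_last (\<beta> + (of_nat j - 1)) s)) (at \<beta>)"
        if "j \<le> J" for j
      proof -
        have "isCont (\<lambda>x. V (butlast s @ [x])) (last s + (\<beta> + (of_nat j - 1)))"
          using cont that by (simp add: shift_last_def)
        hence "isCont (\<lambda>t. V (butlast s @ [last s + (t + (of_nat j - 1))])) \<beta>"
          by (rule isCont_o2[rotated]) (intro continuous_intros)
        thus ?thesis by (simp add: isCont_def shift_last_def)
      qed
      have "((\<lambda>t. (\<Sum>j\<le>J. em_coef j t * V (shift_last (t + (of_nat j - 1)) s)) - err_sum J (s @ [t])) \<longlongrightarrow> g s - 0) (at \<beta>)"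
        unfolding g_def using isCont_em_coef[OF \<beta>] Vlim E
        by (intro tendsto_diff tendsto_sum tendsto_mult) (auto simp: isCont_def)
      thus "((\<lambda>t. W (s @ [t])) \<longlongrightarrow> g s) (at \<beta>)"
        using len by (simp add: W_def merge_snoc nth_append)
    qed
    moreover have "iter_lim g (ys @ [- of_nat a]) (mult_zeta_neg ks 1)"
    proof -
      have "g = (\<lambda>s. \<Sum>j\<le>Suc b. em_coef j \<beta> * V (shift_last (\<beta> + (of_nat j - 1)) s))"
      proof
        fix s
        \<comment> \<open>The factor (-b - 1)_j vanishes. Cutting the sum at b + 1 keeps each
          shifted argument -(a + b + 1 - j) a nonpositive integer, where the induction hypothesis
          supplies the limit.\<close>
        have "em_coef j \<beta> = 0" if "j > Suc b" for j
        proof -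
          have "\<beta> - 1 = - of_nat (Suc b)" by (simp add: \<beta>_def)
          thus ?thesis using pochhammer_of_nat_eq_0_lemma[OF that, where 'a = complex]
            by (simp only: em_coef_def) simp
        qed
        thus "g s = (\<Sum>j\<le>Suc b. em_coef j \<beta> * V (shift_last (\<beta> + (of_nat j - 1)) s))"
          unfolding g_def using bJ by (intro sum.mono_neutral_right) auto
      qed
      moreover have "iter_lim (\<lambda>s. \<Sum>j\<in>{..Suc b}. em_coef j \<beta> * V (shift_last (\<beta> + (of_nat j - 1)) s)) (ys @ [- of_nat a])
          (\<Sum>j\<in>{..Suc b}. em_coef j \<beta> * mult_zeta_neg (xs @ [a + b + 1 - j]) 1)"
      proof (intro iter_lim_sum iter_lim_cmult iter_lim_shift_last)
        fix j assume "j \<in> {..Suc b}"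
        hence j: "j \<le> Suc b" by simp
        have "- of_nat a + (\<beta> + (of_nat j - 1)) = - of_nat (a + b + 1 - j)"
          using j by (simp add: \<beta>_def of_nat_diff)
        moreover have "iter_lim V (map (\<lambda>k. - of_nat k) (xs @ [a + b + 1 - j])) (mult_zeta_neg (xs @ [a + b + 1 - j]) 1)"
        proof (rule VL)
          have "real (a + b + 1 - j) \<le> real a + real b + 1" by simp
          also have "\<dots> < N'" using aN bN N' by linarith
          finally show "\<forall>k\<in>set (xs @ [a + b + 1 - j]). real k < N'" using xN N N' by fastforce
        qed (use xs in simp)
        ultimately show "iter_lim V (ys @ [- of_nat a + (\<beta> + (of_nat j - 1))]) (mult_zeta_neg (xs @ [a + b + 1 - j]) 1)"
          by (simp add: ys_def)
      qed simp
      moreover have "(\<Sum>j\<in>{..Suc b}. em_coef j \<beta> * mult_zeta_neg (xs @ [a + b + 1 - j]) 1) = mult_zeta_neg ks 1"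
        unfolding mult_zeta_neg_def xs(1) \<beta>_def using mzn_rev_em_coef[of b a "rev xs" 1] by simp
      ultimately show ?thesis by simp
    qed
    ultimately have "iter_lim W ((ys @ [- of_nat a]) @ [\<beta>]) (mult_zeta_neg ks 1)" by (rule iter_lim_snoc)
    thus ?thesis by (simp add: xs(1) ys_def \<beta>_def)
  qed
  ultimately show ?thesis unfolding mzv_cont_on_def by blast
qed

lemma ex_mzv_cont_on: "N > 0 \<Longrightarrow> \<exists>W. mzv_cont_on (Suc r) N W"
proof (induction r arbitrary: N)
  case 0
  thus ?case by (rule mzv_cont_on_1)
next
  case (Suc r)
  show ?case using Suc.prems Suc.IH by (rule mzv_cont_on_Suc)
qed

section \<open>Iterated limits of an arbitrary continuation\<close>

theorem theoremE:
  fixes ks :: "nat list" and Z :: "complex list \<Rightarrow> complex"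
  assumes "ks \<noteq> []"
    and "mzv_continuation (length ks) Z"
  shows "iter_lim Z (map (\<lambda>k. - of_nat k) ks) (mult_zeta_neg ks 1)"
proof -
  obtain r where r: "length ks = Suc r" using assms(1) by (cases ks) auto
  obtain z e where z: "meromorphic_Cr (Suc r) Z" "length z = Suc r" "e > 0"
    "\<And>s. s \<in> pdisc z e \<Longrightarrow> (mzv_term s has_sum Z s) (incr_tuples (Suc r))"
    using assms(2) unfolding mzv_continuation_def r by blast
  define as where "as = map (\<lambda>k. - of_nat k :: complex) ks"
  define N where "N = Max (norm ` (set z \<union> set as)) + 1"
  have bound: "norm x < N" if "x \<in> set z \<union> set as" for x
  proof -
    have "norm x \<le> Max (norm ` (set z \<union> set as))" using that by (intro Max_ge) auto
    thus ?thesis by (simp add: N_def)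
  qed
  have zN: "z \<in> pdisc (replicate (Suc r) 0) N" and asN: "as \<in> pdisc (replicate (Suc r) 0) N"
    using bound z(2) r by (auto simp: pdisc_0_iff as_def)
  have "N > 0"
  proof -
    obtain x where "x \<in> set z" using z(2) by (cases z) auto
    hence "norm x < N" by (intro bound) simp
    thus ?thesis by (rule le_less_trans[OF norm_ge_zero])
  qed
  then obtain W where W: "mzv_cont_on (Suc r) N W" using ex_mzv_cont_on by blast
  have "iter_ev (\<lambda>s. Z s = W s) as"
  proof (rule meromorphic_transfer[OF z(1) _ zN z(3) _ asN])
    show "mer W (replicate (Suc r) 0) N" using W by (simp add: mzv_cont_on_def)
    fix s assume "s \<in> pdisc z e" "s \<in> pdisc (replicate (Suc r) 0) N"
    thus "Z s = W s" using W z(4)[of s] unfolding mzv_cont_on_def by (auto simp: has_sum_iff)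
  qed
  moreover have "iter_lim W as (mult_zeta_neg ks 1)"
  proof -
    have "\<forall>k\<in>set ks. real k < N"
    proof
      fix k assume "k \<in> set ks"
      hence "- of_nat k \<in> set as" by (simp add: as_def)
      thus "real k < N" using bound[of "- of_nat k"] by simp
    qed
    thus ?thesis using W r unfolding mzv_cont_on_def as_def by blast
  qed
  ultimately have "iter_lim Z as (mult_zeta_neg ks 1)"
    by (auto elim!: iter_lim_cong iter_ev_mono)
  thus ?thesis by (simp add: as_def)
qed

end
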